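(* Let $n\ge2$ and let $G=(V,E,w_G)$ be an asymptotically flat graph (modelled on $\mathbb{Z}^n$) with non-negative Ricci curvature, i.e. $\kappa(x,y)\ge0$ for every edge $\{x,y\}\in E$. Then $G$ is the standard grid graph, i.e. $G$ is weighted isomorphic to $\mathbb{Z}^n$ with all edge weights equal to $1$.
   Context: **Weighted graphs.** A weighted graph $G=(V,E,w)$ is a locally finite, simple, undirected, connected graph $(V,E)$ with positive symmetric edge weights $w:E\to(0,\infty)$; all vertex weights are $1$. Write $x\sim y$ if $\{x,y\}\in E$; $d$ is the combinatorial graph distance (weights ignored), $B_1(x)=\{y\in V: d(x,y)\le 1\}$. The Laplacian is $\Delta f(x)=\sum_{y\sim x}w(x,y)(f(y)-f(x))$. For $K_1,K_2\subset V$, $E(K_1,K_2)$ is the set of edges $\{x,y\}$ with $x\in K_1$, $y\in K_2$. Two weighted graphs (or induced weighted subgraphs) are weighted isomorphic if there is a bijection of vertices preserving adjacency and non-adjacency, and edge weights. **Curvature.** For $x\ne y$ put $\nabla_{xy}f=\frac{f(x)-f(y)}{d(x,y)}$. The Ollivier (Ricci) curvature is $\kappa(x,y)=\inf \nabla_{xy}\Delta f$, the infimum over all $f:B_1(x)\cup B_1(y)\to\mathbb{R}$ that are $1$-Lipschitz with respect to $d$ and satisfy $\nabla_{yx}f=1$. The scalar curvature is $R(x)=\sum_{y\sim x}\kappa(x,y)$. **Grid graph.** $(\mathbb{Z}^n,w)$ has vertex set $\mathbb{Z}^n$, edges $\{x,y\}$ with $\|x-y\|_1=1$, and edge weights $w$;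 it is standard if $w\equiv1$. $Q_r=\{x\in\mathbb{Z}^n:\|x\|_\infty\le r\}$. Let $e_i$ be the $i$-th standard unit vector and $x_j^\pm=x\pm e_j$. Define $$\mathrm{Abs}(x)=\sum_{i\ne j}\Big(|w(x,x+e_i)-w(x_j^+,x_j^++e_i)|+|w(x,x+e_i)-w(x_j^-,x_j^-+e_i)|+|w(x,x-e_i)-w(x_j^+,x_j^+-e_i)|+|w(x,x-e_i)-w(x_j^-,x_j^--e_i)|\Big),$$ the sum over all ordered pairs $i\neq j$ in $\{1,\dots,n\}$. **Asymptotically flat graph.** $G=(V,E,w_G)$ is asymptotically flat if: (i) there exist $p>n\ge2$ and a weighted grid graph $(\mathbb{Z}^n,w)$ such that, as $|x|\to\infty$ ($|\cdot|$ the Euclidean norm), $w(x,y)=1+o(1)$ for all $y\sim x$, $\mathrm{Abs}(x)=O(|x|^{-p})$ and $|R(x)|=O(|x|^{-p})$ (with $R$ the scalar curvature of $(\mathbb{Z}^n,w)$); (ii) there exist a finite set $K\subset V$, a positive integer $r$, and a weighted isomorphism $\Phi$ from the induced subgraph $(V\setminus K,w_G)$ onto the induced subgraph $(\mathbb{Z}^n\setminus Q_r,w)$ with $E(K,\Phi^{-1}(\mathbb{Z}^n\setminus Q_{r+1}))=\varnothing$. *)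

theory Defs
  imports "HOL-Analysis.Analysis" "HOL-Library.Landau_Symbols"
begin

section \<open>Weighted graphs\<close>

text \<open>Edges are unordered pairs, so the weight of an edge is symmetric by construction; the values
  of \<open>weight\<close> outside \<open>edges\<close> are irrelevant.\<close>

record 'v wgraph =
  verts :: "'v set"
  edges :: "'v set set"
  weight :: "'v set \<Rightarrow> real"

definition adj :: "'v wgraph \<Rightarrow> 'v \<Rightarrow> 'v \<Rightarrow> bool" where
  "adj G x y \<longleftrightarrow> {x, y} \<in> edges G"

definition wt :: "'v wgraph \<Rightarrow> 'v \<Rightarrow> 'v \<Rightarrow> real" where
  "wt G x y = weight G {x, y}"

definition nbrs :: "'v wgraph \<Rightarrow> 'v \<Rightarrow> 'v set" where
  "nbrs G x = {y. adj G x y}"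

definition weighted_graph :: "'v wgraph \<Rightarrow> bool" where
  "weighted_graph G \<longleftrightarrow>
     edges G \<subseteq> {{x, y} | x y. x \<in> verts G \<and> y \<in> verts G \<and> x \<noteq> y} \<and>
     (\<forall>x \<in> verts G. finite (nbrs G x)) \<and>
     (\<forall>x \<in> verts G. \<forall>y \<in> verts G. (x, y) \<in> {(u, v). adj G u v}\<^sup>*) \<and>
     (\<forall>e \<in> edges G. weight G e > 0)"

text \<open>The graph distance is the least length of a walk; it is only meaningful for connected
  vertices.\<close>

definition gdist :: "'v wgraph \<Rightarrow> 'v \<Rightarrow> 'v \<Rightarrow> nat" where
  "gdist G x y = (LEAST k. (x, y) \<in> {(u, v). adj G u v} ^^ k)"

definition ball1 :: "'v wgraph \<Rightarrow> 'v \<Rightarrow> 'v set" where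
  "ball1 G x = {y \<in> verts G. gdist G x y \<le> 1}"

definition edges_between :: "'v wgraph \<Rightarrow> 'v set \<Rightarrow> 'v set \<Rightarrow> 'v set set" where
  "edges_between G A B = {{x, y} | x y. x \<in> A \<and> y \<in> B \<and> adj G x y}"

definition induced :: "'v wgraph \<Rightarrow> 'v set \<Rightarrow> 'v wgraph" where
  "induced G U =
     \<lparr>verts = verts G \<inter> U, edges = {e \<in> edges G. e \<subseteq> U}, weight = weight G\<rparr>"

definition weighted_iso :: "('v \<Rightarrow> 'u) \<Rightarrow> 'v wgraph \<Rightarrow> 'u wgraph \<Rightarrow> bool" where
  "weighted_iso \<phi> G H \<longleftrightarrow>
     bij_betw \<phi> (verts G) (verts H) \<and>
     (\<forall>x \<in> verts G. \<forall>y \<in> verts G.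
        (adj G x y \<longleftrightarrow> adj H (\<phi> x) (\<phi> y)) \<and>
        (adj G x y \<longrightarrow> wt G x y = wt H (\<phi> x) (\<phi> y)))"

definition weighted_isomorphic :: "'v wgraph \<Rightarrow> 'u wgraph \<Rightarrow> bool" where
  "weighted_isomorphic G H \<longleftrightarrow> (\<exists>\<phi>. weighted_iso \<phi> G H)"


section \<open>Curvature\<close>

definition laplacian :: "'v wgraph \<Rightarrow> ('v \<Rightarrow> real) \<Rightarrow> 'v \<Rightarrow> real" where
  "laplacian G f x = (\<Sum>y \<in> nbrs G x. wt G x y * (f y - f x))"

definition grad :: "'v wgraph \<Rightarrow> 'v \<Rightarrow> 'v \<Rightarrow> ('v \<Rightarrow> real) \<Rightarrow> real" where
  "grad G x y f = (f x - f y) / real (gdist G x y)"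

definition lip1_on :: "'v wgraph \<Rightarrow> 'v set \<Rightarrow> ('v \<Rightarrow> real) \<Rightarrow> bool" where
  "lip1_on G U f \<longleftrightarrow> (\<forall>u \<in> U. \<forall>v \<in> U. \<bar>f u - f v\<bar> \<le> real (gdist G u v))"

text \<open>The test functions live on \<open>B\<^sub>1(x) \<union> B\<^sub>1(y)\<close>.  They are represented by total functions
  constrained only on that set; their values elsewhere do not enter \<open>\<Delta>f(x)\<close> or \<open>\<Delta>f(y)\<close>.
  In a weighted graph and for \<open>x \<noteq> y\<close>, the infimum is over a non-empty set bounded below.\<close>

definition ollivier :: "'v wgraph \<Rightarrow> 'v \<Rightarrow> 'v \<Rightarrow> real" where
  "ollivier G x y =
     Inf {grad G x y (laplacian G f) | f. lip1_on G (ball1 G x \<union> ball1 G y) f \<and> grad G y x f = 1}"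

definition scalar_curv :: "'v wgraph \<Rightarrow> 'v \<Rightarrow> real" where
  "scalar_curv G x = (\<Sum>y \<in> nbrs G x. ollivier G x y)"

definition nonneg_ricci :: "'v wgraph \<Rightarrow> bool" where
  "nonneg_ricci G \<longleftrightarrow> (\<forall>x y. adj G x y \<longrightarrow> ollivier G x y \<ge> 0)"


section \<open>Grid graphs\<close>

text \<open>The lattice \<open>\<int>\<^sup>n\<close> is the type \<open>int ^ 'n\<close> with \<open>n = CARD('n)\<close>, and \<open>e\<^sub>i = axis i 1\<close>.\<close>

definition grid_graph :: "((int ^ 'n) set \<Rightarrow> real) \<Rightarrow> (int ^ 'n) wgraph" where
  "grid_graph w =
     \<lparr>verts = UNIV, edges = {{x, y} | x y. (\<Sum>i \<in> UNIV. \<bar>x $ i - y $ i\<bar>) = 1}, weight = w\<rparr>"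

definition standard_grid :: "(int ^ 'n) wgraph" where
  "standard_grid = grid_graph (\<lambda>_. 1)"

definition cube :: "nat \<Rightarrow> (int ^ 'n) set" where
  "cube r = {x. \<forall>i. \<bar>x $ i\<bar> \<le> int r}"

definition enorm :: "int ^ 'n \<Rightarrow> real" where
  "enorm x = norm (\<chi> i. real_of_int (x $ i))"

text \<open>The filter \<open>|x| \<rightarrow> \<infinity>\<close> on \<open>\<int>\<^sup>n\<close>.\<close>

definition at_grid_infinity :: "(int ^ 'n) filter" where
  "at_grid_infinity = filtercomap enorm at_top"

definition Abs_var :: "(int ^ 'n) wgraph \<Rightarrow> int ^ 'n \<Rightarrow> real" where
  "Abs_var Z x =
     (\<Sum>i \<in> UNIV. \<Sum>j \<in> UNIV - {i}.
        (let ei = axis i 1; xp = x + axis j 1; xm = x - axis j 1 in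
           \<bar>wt Z x (x + ei) - wt Z xp (xp + ei)\<bar>
         + \<bar>wt Z x (x + ei) - wt Z xm (xm + ei)\<bar>
         + \<bar>wt Z x (x - ei) - wt Z xp (xp - ei)\<bar>
         + \<bar>wt Z x (x - ei) - wt Z xm (xm - ei)\<bar>))"


section \<open>Asymptotically flat graphs\<close>

definition flat_grid :: "real \<Rightarrow> (int ^ 'n) wgraph \<Rightarrow> bool" where
  "flat_grid p Z \<longleftrightarrow>
     (\<forall>\<epsilon> > 0. \<forall>\<^sub>F x in at_grid_infinity. \<forall>y. adj Z x y \<longrightarrow> \<bar>wt Z x y - 1\<bar> < \<epsilon>) \<and>
     Abs_var Z \<in> O[at_grid_infinity](\<lambda>x. enorm x powr (- p)) \<and>
     (\<lambda>x. \<bar>scalar_curv Z x\<bar>) \<in> O[at_grid_infinity](\<lambda>x. enorm x powr (- p))"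

text \<open>Asymptotic flatness modelled on \<open>\<int>\<^sup>n\<close>; the type argument supplies the dimension
  \<open>n = CARD('n)\<close>.\<close>

definition asymptotically_flat :: "'n::finite itself \<Rightarrow> 'v wgraph \<Rightarrow> bool" where
  "asymptotically_flat TYPE('n) G \<longleftrightarrow>
     2 \<le> CARD('n) \<and>
     (\<exists>(p :: real) (w :: (int ^ 'n) set \<Rightarrow> real).
        p > real CARD('n) \<and>
        weighted_graph (grid_graph w) \<and>
        flat_grid p (grid_graph w) \<and>
        (\<exists>K r \<Phi>.
           finite K \<and> K \<subseteq> verts G \<and> r > 0 \<and>
           weighted_iso \<Phi> (induced G (verts G - K)) (induced (grid_graph w) (- cube r)) \<and>
           edges_between G K {v \<in> verts G - K. \<Phi> v \<in> - cube (r + 1)} = {}))"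

end

theory Submission
  imports Defs
begin

text \<open>Non-negative Ollivier curvature of \<open>x \<sim> y\<close> means that \<open>\<Delta>f(y) \<le> \<Delta>f(x)\<close> for every
  1-Lipschitz \<open>f\<close> with \<open>f(y) = f(x) + 1\<close>. For a sign vector \<open>e \<in> {-1, 0, 1}\<^sup>n\<close> let \<open>b\<^sub>e\<close> be
  the Busemann function, which is \<open>e \<bullet> x\<close> on a half space far from the core. Since it can be climbed
  by unit steps from every vertex, and its Laplacian tends to 0 at infinity as the weights tend to 1,
  \<open>b\<^sub>e\<close> is subharmonic. So is \<open>b\<^sub>e + b\<^sub>-\<^sub>e\<close>, which is integer-valued, bounded above, and 0 at
  points far out in a direction orthogonal to \<open>e\<close> (here \<open>n \<ge> 2\<close> enters); by the maximum principle
  it vanishes, so \<open>b\<^sub>e\<close> is harmonic. By the maximum principle again \<open>b\<^sub>e = \<Sum>\<^sub>i e\<^sub>i F\<^sub>i\<close> with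
  \<open>F\<^sub>i = b\<^sub>e\<^sub>i\<close>, and hence \<open>F : V \<rightarrow> \<int>\<^sup>n\<close> is 1-Lipschitz for the l1 norm. Testing the
  curvature with \<open>F\<^sub>i \<plusminus> max (F\<^sub>j - c) 0\<close> shows that the total weight from a vertex to the fibre in
  direction \<open>e\<^sub>j\<close> is constant along unit steps in direction \<open>e\<^sub>i\<close>, hence equal to its limit 1. Then
  neighbouring fibres of \<open>F\<close> have equal cardinality, so all are singletons, and \<open>F\<close> is the
  isomorphism.\<close>

section \<open>The l1 norm on the lattice\<close>

definition norm1 :: "int ^ 'n \<Rightarrow> int" where
  "norm1 x = (\<Sum>i\<in>UNIV. \<bar>x $ i\<bar>)"

definition dot :: "int ^ 'n \<Rightarrow> int ^ 'n \<Rightarrow> int" where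
  "dot e x = (\<Sum>i\<in>UNIV. e $ i * x $ i)"

lemma norm1_nonneg [simp]: "0 \<le> norm1 x"
  by (simp add: norm1_def sum_nonneg)

lemma norm1_triangle: "norm1 (x + y) \<le> norm1 x + norm1 y"
  unfolding norm1_def sum.distrib[symmetric] by (intro sum_mono) simp

lemma norm1_minus [simp]: "norm1 (- x) = norm1 x"
  by (simp add: norm1_def)

lemma norm1_commute: "norm1 (x - y) = norm1 (y - x)"
  by (simp add: norm1_def abs_minus_commute)

lemma norm1_diff_le: "norm1 x \<le> norm1 y + norm1 (x - y)"
  using norm1_triangle[of y "x - y"] by simp

lemma component_le_norm1: "\<bar>x $ i\<bar> \<le> norm1 x"
  unfolding norm1_def by (rule member_le_sum) auto

lemma norm1_eq_0 [simp]: "norm1 x = 0 \<longleftrightarrow> x = 0"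
  by (simp add: norm1_def sum_nonneg_eq_0_iff vec_eq_iff)

lemma norm1_axis [simp]: "norm1 (axis i c) = \<bar>c\<bar>"
proof -
  have "norm1 (axis i c) = (\<Sum>j\<in>UNIV. if j = i then \<bar>c\<bar> else 0)"
    unfolding norm1_def by (intro sum.cong) (auto simp: axis_def)
  then show ?thesis by simp
qed

lemma norm1_remove_le:
  assumes "j \<noteq> i"
  shows "\<bar>x $ i\<bar> + \<bar>x $ j\<bar> \<le> norm1 x"
proof -
  have "(\<Sum>k\<in>{i, j}. \<bar>x $ k\<bar>) \<le> norm1 x"
    unfolding norm1_def by (rule sum_mono2) auto
  then show ?thesis using assms by simp
qed

lemma norm1_le_1_component:
  assumes "norm1 x \<le> 1" "\<bar>x $ i\<bar> = 1"
  shows "x = axis i (x $ i)"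
proof -
  have "x $ j = 0" if "j \<noteq> i" for j
    using norm1_remove_le[OF that, of x] assms by auto
  then show ?thesis by (auto simp: vec_eq_iff axis_def)
qed

lemma norm1_eq_1E:
  assumes "norm1 x = 1"
  obtains i where "x = axis i 1" | i where "x = axis i (-1)"
proof -
  have "x \<noteq> 0" using assms norm1_eq_0[of x] by auto
  then obtain i where i: "x $ i \<noteq> 0" by (auto simp: vec_eq_iff)
  then have "\<bar>x $ i\<bar> = 1" using component_le_norm1[of x i] assms by simp
  then show ?thesis
    using norm1_le_1_component[of x i] assms that by (cases "x $ i \<ge> 0") auto
qed

lemma finite_norm1_le: "finite {x :: int ^ 'n. norm1 x \<le> L}"
proof (rule finite_subset)
  show "{x :: int ^ 'n. norm1 x \<le> L} \<subseteq> vec_lambda ` (UNIV \<rightarrow>\<^sub>E {-L..L})"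
  proof
    fix x :: "int ^ 'n" assume "x \<in> {x. norm1 x \<le> L}"
    then have "\<bar>x $ i\<bar> \<le> L" for i using component_le_norm1[of x i] by simp
    then have "- L \<le> x $ i \<and> x $ i \<le> L" for i by (smt (verit))
    then show "x \<in> vec_lambda ` (UNIV \<rightarrow>\<^sub>E {-L..L})"
      by (intro image_eqI[of _ _ "vec_nth x"]) (auto simp: PiE_def)
  qed
  show "finite (vec_lambda ` (UNIV \<rightarrow>\<^sub>E {-L..L}) :: (int ^ 'n) set)"
    by (intro finite_imageI finite_PiE) auto
qed

lemma dot_add: "dot e (x + y) = dot e x + dot e y"
  by (simp add: dot_def algebra_simps sum.distrib)

lemma dot_diff: "dot e (x - y) = dot e x - dot e y"
  by (simp add: dot_def algebra_simps sum_subtractf)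

lemma dot_minus_left [simp]: "dot (- e) x = - dot e x"
  by (simp add: dot_def sum_negf)

lemma dot_axis_right [simp]: "dot e (axis i c) = e $ i * c"
proof -
  have "dot e (axis i c) = (\<Sum>j\<in>UNIV. if j = i then e $ i * c else 0)"
    unfolding dot_def by (intro sum.cong) (auto simp: axis_def)
  then show ?thesis by simp
qed

lemma dot_axis_left [simp]: "dot (axis i c) x = c * x $ i"
proof -
  have "dot (axis i c) x = (\<Sum>j\<in>UNIV. if j = i then c * x $ i else 0)"
    unfolding dot_def by (intro sum.cong) (auto simp: axis_def)
  then show ?thesis by simp
qed

lemma dot_le_norm1:
  assumes "\<And>i. \<bar>e $ i\<bar> \<le> 1"
  shows "\<bar>dot e x\<bar> \<le> norm1 x"
proof -
  have "\<bar>dot e x\<bar> \<le> (\<Sum>i\<in>UNIV. \<bar>e $ i * x $ i\<bar>)"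
    unfolding dot_def by (rule sum_abs)
  also have "\<dots> \<le> norm1 x"
    unfolding norm1_def abs_mult using assms by (intro sum_mono mult_left_le_one_le) auto
  finally show ?thesis .
qed

section \<open>Connected weighted graphs\<close>

locale conn_wgraph =
  fixes G :: "'v wgraph"
  assumes weighted_graph: "weighted_graph G"
begin

abbreviation E :: "('v \<times> 'v) set" where "E \<equiv> {(u, v). adj G u v}"

section \<open>Edges, graph distance and functions that are Lipschitz along edges\<close>

lemma adj_verts: "adj G x y \<Longrightarrow> x \<in> verts G \<and> y \<in> verts G \<and> x \<noteq> y"
  using weighted_graph unfolding weighted_graph_def adj_def by (auto simp: doubleton_eq_iff)

lemma adj_sym: "adj G x y \<Longrightarrow> adj G y x"
  by (simp add: adj_def insert_commute)

lemma wt_sym: "wt G x y = wt G y x"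
  by (simp add: wt_def insert_commute)

lemma wt_pos: "adj G x y \<Longrightarrow> 0 < wt G x y"
  using weighted_graph unfolding weighted_graph_def adj_def wt_def by auto

lemma finite_nbrs: "x \<in> verts G \<Longrightarrow> finite (nbrs G x)"
  using weighted_graph unfolding weighted_graph_def by auto

lemma connected: "x \<in> verts G \<Longrightarrow> y \<in> verts G \<Longrightarrow> (x, y) \<in> E\<^sup>*"
  using weighted_graph unfolding weighted_graph_def by auto

lemma gdist_relpow: "x \<in> verts G \<Longrightarrow> y \<in> verts G \<Longrightarrow> (x, y) \<in> E ^^ gdist G x y"
  unfolding gdist_def by (rule LeastI_ex) (use connected rtrancl_power in blast)

lemma gdist_le: "(x, y) \<in> E ^^ k \<Longrightarrow> gdist G x y \<le> k"
  unfolding gdist_def by (rule Least_le)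

lemma gdist_self [simp]: "gdist G x x = 0"
  using gdist_le[of x x 0] by simp

lemma gdist_adj:
  assumes "adj G x y"
  shows "gdist G x y = 1"
proof -
  have "gdist G x y \<le> 1" using gdist_le[of x y 1] assms by simp
  moreover have "gdist G x y \<noteq> 0"
    using gdist_relpow[of x y] adj_verts[OF assms] by (metis relpow_0_E)
  ultimately show ?thesis by simp
qed

text \<open>Stated over any ordered domain to serve both real test functions and the integer-valued
  \<open>barrier\<close>.\<close>

lemma edge_lip_relpow:
  fixes f :: "'v \<Rightarrow> 'a :: linordered_idom"
  assumes "\<And>u v. adj G u v \<Longrightarrow> \<bar>f u - f v\<bar> \<le> 1" and "(u, v) \<in> E ^^ k"
  shows "\<bar>f u - f v\<bar> \<le> of_nat k"
  using assms(2)
proof (induction k arbitrary: v)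
  case (Suc k)
  then obtain z where z: "(u, z) \<in> E ^^ k" "adj G z v" by auto
  show ?case using Suc.IH[OF z(1)] assms(1)[OF z(2)] by (simp add: abs_le_iff)
qed auto

lemma edge_lip_lip1_on:
  assumes "\<And>u v. adj G u v \<Longrightarrow> \<bar>f u - f v\<bar> \<le> (1 :: real)" and "U \<subseteq> verts G"
  shows "lip1_on G U f"
  unfolding lip1_on_def
proof (intro ballI)
  fix u v assume "u \<in> U" "v \<in> U"
  then have "(u, v) \<in> E ^^ gdist G u v" using gdist_relpow assms(2) by auto
  from edge_lip_relpow[of f, OF assms(1) this] show "\<bar>f u - f v\<bar> \<le> real (gdist G u v)" by simp
qed

lemma nbrs_subset_ball1: "nbrs G x \<subseteq> ball1 G x"
proof
  fix y assume "y \<in> nbrs G x"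
  then have "adj G x y" by (simp add: nbrs_def)
  then show "y \<in> ball1 G x" using gdist_adj[of x y] adj_verts[of x y] by (simp add: ball1_def)
qed

text \<open>Supplies the lower bound that makes the infimum in \<open>ollivier\<close> a genuine
  one.\<close>

lemma laplacian_bound:
  assumes "lip1_on G U f" "ball1 G x \<subseteq> U" "x \<in> verts G"
  shows "\<bar>laplacian G f x\<bar> \<le> (\<Sum>y\<in>nbrs G x. wt G x y)"
proof -
  have "\<bar>laplacian G f x\<bar> \<le> (\<Sum>y\<in>nbrs G x. \<bar>wt G x y * (f y - f x)\<bar>)"
    unfolding laplacian_def by (rule sum_abs)
  also have "\<dots> \<le> (\<Sum>y\<in>nbrs G x. wt G x y)"
  proof (rule sum_mono)
    fix y assume y: "y \<in> nbrs G x"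
    then have a: "adj G x y" by (simp add: nbrs_def)
    have "y \<in> U" "x \<in> U"
      using y nbrs_subset_ball1 assms(2,3) by (auto simp: ball1_def)
    then have "\<bar>f x - f y\<bar> \<le> 1"
      using assms(1) gdist_adj[OF a] by (fastforce simp: lip1_on_def)
    then show "\<bar>wt G x y * (f y - f x)\<bar> \<le> wt G x y"
      using wt_pos[OF a] by (simp add: abs_mult abs_minus_commute mult_left_le)
  qed
  finally show ?thesis .
qed

text \<open>A single test function bounds the infimum from above; \<open>gdist\<close> is 1 on an
  edge, so the normalisation of the gradient becomes \<open>f y = f x + 1\<close>.\<close>

lemma ollivier_le:
  assumes lip: "\<And>u v. adj G u v \<Longrightarrow> \<bar>f u - f v\<bar> \<le> 1"
    and xy: "adj G x y" and up: "f y = f x + 1"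
  shows "ollivier G x y \<le> laplacian G f x - laplacian G f y"
proof -
  let ?U = "ball1 G x \<union> ball1 G y"
  let ?A = "{grad G x y (laplacian G f) | f. lip1_on G ?U f \<and> grad G y x f = 1}"
  have v: "x \<in> verts G" "y \<in> verts G" using adj_verts[OF xy] by auto
  have d: "gdist G x y = 1" "gdist G y x = 1" using gdist_adj xy adj_sym by auto
  have "bdd_below ?A"
  proof (rule bdd_belowI)
    fix a assume "a \<in> ?A"
    then obtain g where g: "a = grad G x y (laplacian G g)" "lip1_on G ?U g" by auto
    show "- ((\<Sum>z\<in>nbrs G x. wt G x z) + (\<Sum>z\<in>nbrs G y. wt G y z)) \<le> a"
      using laplacian_bound[OF g(2) _ v(1)] laplacian_bound[OF g(2) _ v(2)] g(1) d
      by (simp add: grad_def abs_le_iff)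
  qed
  moreover have "lip1_on G ?U f"
    by (rule edge_lip_lip1_on[OF lip]) (auto simp: ball1_def)
  then have "laplacian G f x - laplacian G f y \<in> ?A"
    using up d by (force simp: grad_def)
  ultimately show ?thesis unfolding ollivier_def by (rule cInf_lower[rotated])
qed

section \<open>Linearity of the Laplacian\<close>

lemma laplacian_add: "laplacian G (\<lambda>u. f u + g u) v = laplacian G f v + laplacian G g v"
  by (simp add: laplacian_def algebra_simps sum.distrib sum_subtractf)

lemma laplacian_cmult: "laplacian G (\<lambda>u. c * f u) v = c * laplacian G f v"
  by (simp add: laplacian_def algebra_simps sum_distrib_left)

lemma laplacian_uminus: "laplacian G (\<lambda>u. - f u) v = - laplacian G f v"
  using laplacian_cmult[of "-1" f v] by simp

lemma laplacian_diff: "laplacian G (\<lambda>u. f u - g u) v = laplacian G f v - laplacian G g v"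
  using laplacian_add[of f "\<lambda>u. - g u" v] laplacian_uminus[of g v] by simp

lemma laplacian_sum:
  "finite I \<Longrightarrow> laplacian G (\<lambda>u. \<Sum>i\<in>I. f i u) v = (\<Sum>i\<in>I. laplacian G (f i) v)"
proof (induction I rule: finite_induct)
  case empty
  then show ?case by (simp add: laplacian_def)
next
  case (insert i I)
  then show ?case by (simp add: laplacian_add)
qed

lemma laplacian_cong:
  assumes "f v = g v" "\<And>u. adj G v u \<Longrightarrow> f u = g u"
  shows "laplacian G f v = laplacian G g v"
  unfolding laplacian_def using assms by (intro sum.cong) (auto simp: nbrs_def)

text \<open>Maximum principle on a possibly infinite graph: an integer-valued function bounded above
  attains its maximum, and the maximum spreads along edges.\<close>

lemma subharmonic_bounded_const:
  fixes s :: "'v \<Rightarrow> int"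
  assumes sub: "\<And>v. v \<in> verts G \<Longrightarrow> 0 \<le> laplacian G (\<lambda>u. real_of_int (s u)) v"
    and bd: "\<And>v. v \<in> verts G \<Longrightarrow> s v \<le> b"
    and u: "u \<in> verts G" and v: "v \<in> verts G"
  shows "s u = s v"
proof -
  obtain m where m: "m \<in> verts G" "\<And>y. y \<in> verts G \<Longrightarrow> nat (b - s m) \<le> nat (b - s y)"
    using ex_has_least_nat[of "\<lambda>x. x \<in> verts G" u "\<lambda>x. nat (b - s x)"] u by auto
  have mx: "s y \<le> s m" if "y \<in> verts G" for y
    using m(2)[OF that] bd[OF that] bd[OF m(1)] by simp
  have step: "s z = s m" if "adj G y z" "s y = s m" for y z
  proof -
    \<comment> \<open>At a maximum all terms of the negated Laplacian are non-negative while their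
      sum is at most 0, so each vanishes.\<close>
    let ?t = "\<lambda>x. wt G y x * (real_of_int (s y) - real_of_int (s x))"
    have y: "y \<in> verts G" using adj_verts that by auto
    have nn: "0 \<le> ?t x" if "x \<in> nbrs G y" for x
      using that wt_pos[of y x] mx[of x] adj_verts[of y x] \<open>s y = s m\<close>
      by (simp add: nbrs_def less_imp_le)
    have "(\<Sum>x\<in>nbrs G y. ?t x) = - laplacian G (\<lambda>u. real_of_int (s u)) y"
      unfolding laplacian_def sum_negf[symmetric] by (intro sum.cong) (auto simp: algebra_simps)
    then have "(\<Sum>x\<in>nbrs G y. ?t x) \<le> 0" using sub[OF y] by simp
    then have "(\<Sum>x\<in>nbrs G y. ?t x) = 0" using nn sum_nonneg[of "nbrs G y" ?t] by force
    then have "?t z = 0"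
      using sum_nonneg_eq_0_iff[OF finite_nbrs[OF y], of ?t] nn that(1) by (simp add: nbrs_def)
    then show ?thesis using wt_pos[OF that(1)] that(2) by simp
  qed
  have "s x = s m" if "x \<in> verts G" for x
    using connected[OF m(1) that] by (induction rule: rtrancl_induct) (auto intro: step)
  then show ?thesis using u v by simp
qed

text \<open>Iterated unit ascent; the invariant \<open>P\<close> carries information from
  \<open>v\<close> to arbitrarily high levels.\<close>

lemma climb:
  fixes f :: "'v \<Rightarrow> int"
  assumes "\<And>v. v \<in> verts G \<Longrightarrow> \<exists>u. adj G v u \<and> f u = f v + 1"
    and "\<And>u v. adj G v u \<Longrightarrow> f u = f v + 1 \<Longrightarrow> P v \<Longrightarrow> P u"
    and "v \<in> verts G" "P v"
  shows "\<exists>u\<in>verts G. f u = f v + int k \<and> P u"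
proof (induction k)
  case 0
  then show ?case using assms(3,4) by auto
next
  case (Suc k)
  then obtain u where u: "u \<in> verts G" "f u = f v + int k" "P u" by auto
  obtain z where "adj G u z" "f z = f u + 1" using assms(1)[OF u(1)] by auto
  then show ?case using assms(2)[of u z] adj_verts[of u z] u by (intro bexI[of _ z]) auto
qed

section \<open>Distance to a set of vertices\<close>

definition dset :: "'v set \<Rightarrow> 'v \<Rightarrow> nat" where
  "dset H v = (LEAST k. \<exists>u\<in>H. (v, u) \<in> E ^^ k)"

lemma dset_le: "u \<in> H \<Longrightarrow> (v, u) \<in> E ^^ k \<Longrightarrow> dset H v \<le> k"
  unfolding dset_def by (rule Least_le) auto

lemma dset_attained:
  assumes "H \<noteq> {}" "H \<subseteq> verts G" "v \<in> verts G"
  shows "\<exists>u\<in>H. (v, u) \<in> E ^^ dset H v"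
proof -
  obtain h where h: "h \<in> H" using assms by auto
  then have "(v, h) \<in> E\<^sup>*" using connected[of v h] assms(2,3) by blast
  then obtain k where "(v, h) \<in> E ^^ k" using rtrancl_imp_relpow by metis
  then have "\<exists>u\<in>H. (v, u) \<in> E ^^ k" using h by (rule bexI)
  then show ?thesis unfolding dset_def by (rule LeastI)
qed

lemma dset_eq_0:
  assumes "H \<noteq> {}" "H \<subseteq> verts G" "v \<in> verts G"
  shows "dset H v = 0 \<longleftrightarrow> v \<in> H"
  using dset_attained[OF assms] dset_le[of v H v 0] by (auto split: if_splits)

lemma dset_adj_le:
  assumes "H \<noteq> {}" "H \<subseteq> verts G" "adj G v u"
  shows "dset H v \<le> dset H u + 1"
proof -
  obtain h where "h \<in> H" "(u, h) \<in> E ^^ dset H u"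
    using dset_attained[OF assms(1,2), of u] adj_verts assms(3) by auto
  then have "(v, h) \<in> E ^^ Suc (dset H u)"
    using assms(3) by (metis case_prodI mem_Collect_eq relpow_Suc_I2)
  then show ?thesis using dset_le[OF \<open>h \<in> H\<close>] by fastforce
qed

lemma dset_step:
  assumes "H \<noteq> {}" "H \<subseteq> verts G" "v \<in> verts G" "v \<notin> H"
  obtains u where "adj G v u" "dset H v = dset H u + 1"
proof -
  obtain k where k: "dset H v = Suc k"
    using dset_eq_0[OF assms(1-3)] assms(4) by (cases "dset H v") auto
  obtain h where "h \<in> H" "(v, h) \<in> E ^^ Suc k"
    using dset_attained[OF assms(1-3)] k by auto
  then obtain u where u: "adj G v u" "(u, h) \<in> E ^^ k" by (metis (no_types, lifting) relpow_Suc_D2 case_prodD mem_Collect_eq)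
  have "dset H u \<le> k" using dset_le[OF \<open>h \<in> H\<close> u(2)] .
  then have "dset H v = dset H u + 1"
    using dset_adj_le[OF assms(1,2) u(1)] k by simp
  then show ?thesis using u(1) that by blast
qed

end

locale nonneg_wgraph = conn_wgraph G for G :: "'v wgraph" +
  assumes nonneg: "nonneg_ricci G"
begin

lemma laplacian_antimono:
  assumes "\<And>u v. adj G u v \<Longrightarrow> \<bar>f u - f v\<bar> \<le> (1 :: real)" "adj G x y" "f y = f x + 1"
  shows "laplacian G f y \<le> laplacian G f x"
  using ollivier_le[OF assms] nonneg assms(2) unfolding nonneg_ricci_def by fastforce

text \<open>By \<open>laplacian_antimono\<close> the Laplacian does not increase along unit ascents.
  Climbing from \<open>v\<close> reaches the region where it is at least \<open>- \<eta>\<close>, so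
  it is at least \<open>- \<eta>\<close> at \<open>v\<close>, for every
  \<open>\<eta>\<close>.\<close>

lemma laplacian_nonneg_of_climb:
  fixes f :: "'v \<Rightarrow> int"
  assumes lip: "\<And>u v. adj G u v \<Longrightarrow> \<bar>f u - f v\<bar> \<le> 1"
    and up: "\<And>v. v \<in> verts G \<Longrightarrow> \<exists>u. adj G v u \<and> f u = f v + 1"
    and inf: "\<And>\<eta>. 0 < \<eta> \<Longrightarrow>
      \<exists>L. \<forall>v\<in>verts G. L \<le> f v \<longrightarrow> - \<eta> \<le> laplacian G (\<lambda>u. real_of_int (f u)) v"
    and v: "v \<in> verts G"
  shows "0 \<le> laplacian G (\<lambda>u. real_of_int (f u)) v"
proof -
  let ?D = "laplacian G (\<lambda>u. real_of_int (f u))"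
  have "- \<eta> \<le> ?D v" if eta: "0 < \<eta>" for \<eta>
  proof -
    obtain L where L: "\<And>u. u \<in> verts G \<Longrightarrow> L \<le> f u \<Longrightarrow> - \<eta> \<le> ?D u"
      using inf[OF eta] by auto
    have mono: "?D u \<le> ?D w" if "adj G w u" "f u = f w + 1" for u w
    proof (rule laplacian_antimono[OF _ that(1)])
      show "\<bar>real_of_int (f a) - real_of_int (f b)\<bar> \<le> 1" if "adj G a b" for a b
        using lip[OF that] by linarith
    qed (use that in simp)
    have "\<exists>u\<in>verts G. f u = f v + int (nat (L - f v)) \<and> ?D u \<le> ?D v"
      by (rule climb[OF up _ v]) (use mono in fastforce)+
    then obtain u where "u \<in> verts G" "f u = f v + int (nat (L - f v))" "?D u \<le> ?D v" by auto
    then show ?thesis using L[of u] by linarith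
  qed
  then have "0 \<le> ?D v + \<eta>" if "0 < \<eta>" for \<eta> using that by fastforce
  then show ?thesis by (rule field_le_epsilon)
qed

end

section \<open>Graphs that are a lattice outside a finite core\<close>

text \<open>The removed region is an l1 ball because \<open>dot\<close> is controlled by
  \<open>norm1\<close>. By \<open>adj_core\<close>, edges into the core start only on the innermost
  sphere, of radius \<open>C + 1\<close>.\<close>

locale flat_end = nonneg_wgraph G for G :: "'v wgraph" +
  fixes core :: "'v set" and X :: "'v \<Rightarrow> int ^ 'n::finite" and C :: int
  assumes dim: "2 \<le> CARD('n)"
    and finite_core: "finite core"
    and C_nonneg: "0 \<le> C"
    and X_bij: "bij_betw X (verts G - core) {x. C < norm1 x}"
    and adj_X: "\<And>u v. u \<in> verts G - core \<Longrightarrow> v \<in> verts G - core \<Longrightarrow>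
      adj G u v \<longleftrightarrow> norm1 (X u - X v) = 1"
    and adj_core: "\<And>u v. u \<in> verts G - core \<Longrightarrow> v \<in> core \<Longrightarrow> adj G u v \<Longrightarrow>
      norm1 (X u) \<le> C + 1"
    and weights: "\<And>\<eta>. 0 < \<eta> \<Longrightarrow> \<exists>L. \<forall>u\<in>verts G - core. L \<le> norm1 (X u) \<longrightarrow>
      (\<forall>v. adj G u v \<longrightarrow> \<bar>wt G u v - 1\<bar> \<le> \<eta>)"
begin

abbreviation out :: "'v set" where "out \<equiv> verts G - core"

section \<open>The chart outside the core\<close>

lemma ex_other: "\<exists>j :: 'n. j \<noteq> i"
proof (rule ccontr)
  assume "\<nexists>j. j \<noteq> i"
  then have "(UNIV :: 'n set) = {i}" by auto
  then show False using dim
    by (metis card_1_singleton_iff One_nat_def Suc_1 not_less_eq_eq order_refl)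
qed

definition Xi :: "int ^ 'n \<Rightarrow> 'v" where "Xi = inv_into out X"

lemma Xi_out: "C < norm1 x \<Longrightarrow> Xi x \<in> out"
  unfolding Xi_def by (rule inv_into_into) (use X_bij in \<open>auto simp: bij_betw_def\<close>)

lemma X_Xi: "C < norm1 x \<Longrightarrow> X (Xi x) = x"
  unfolding Xi_def by (rule f_inv_into_f) (use X_bij in \<open>auto simp: bij_betw_def\<close>)

lemma Xi_X: "v \<in> out \<Longrightarrow> Xi (X v) = v"
  unfolding Xi_def by (rule inv_into_f_f) (use X_bij in \<open>auto simp: bij_betw_def\<close>)

lemma out_norm1: "v \<in> out \<Longrightarrow> C < norm1 (X v)"
  using X_bij by (auto simp: bij_betw_def)

lemma nbr_out:
  assumes "v \<in> out" "C + 2 \<le> norm1 (X v)" "adj G v u"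
  shows "u \<in> out" "norm1 (X v - X u) = 1"
proof -
  show u: "u \<in> out" using adj_core[OF assms(1) _ assms(3)] adj_verts[OF assms(3)] assms(2) by force
  show "norm1 (X v - X u) = 1" using adj_X[OF assms(1) u] assms(3) by simp
qed

text \<open>Radius \<open>C + 2\<close> leaves room outside the core for the whole unit sphere
  around \<open>X v\<close>.\<close>

lemma bij_nbrs:
  assumes "v \<in> out" "C + 2 \<le> norm1 (X v)"
  shows "bij_betw (\<lambda>u. X u - X v) (nbrs G v) {d. norm1 d = 1}"
proof (rule bij_betw_byWitness[where f' = "\<lambda>d. Xi (X v + d)"])
  have far: "C < norm1 (X v + d)" if "norm1 d = 1" for d
    using that assms(2) norm1_diff_le[of "X v" "X v + d"] by simp
  show "\<forall>u\<in>nbrs G v. Xi (X v + (X u - X v)) = u"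
    using nbr_out(1)[OF assms] Xi_X by (auto simp: nbrs_def)
  show "\<forall>d\<in>{d. norm1 d = 1}. X (Xi (X v + d)) - X v = d"
    using far X_Xi by simp
  show "(\<lambda>u. X u - X v) ` nbrs G v \<subseteq> {d. norm1 d = 1}"
    using nbr_out(2)[OF assms] by (auto simp: nbrs_def norm1_commute)
  show "(\<lambda>d. Xi (X v + d)) ` {d. norm1 d = 1} \<subseteq> nbrs G v"
    using far X_Xi Xi_out adj_X[OF assms(1)] by (auto simp: nbrs_def)
qed

text \<open>With unit weights the contributions of \<open>d\<close> and \<open>- d\<close> to the
  Laplacian of a linear function cancel; what remains is the deviation of the weights from 1, at
  most \<open>\<eta>\<close> per neighbour.\<close>

lemma laplacian_far:
  assumes v: "v \<in> out" "C + 2 \<le> norm1 (X v)"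
    and e: "\<And>i. \<bar>e $ i\<bar> \<le> 1"
    and f: "\<And>u. adj G v u \<Longrightarrow> f u - f v = real_of_int (dot e (X u - X v))"
    and w: "\<And>u. adj G v u \<Longrightarrow> \<bar>wt G v u - 1\<bar> \<le> \<eta>"
  shows "\<bar>laplacian G f v\<bar> \<le> real (card {d :: int ^ 'n. norm1 d = 1}) * \<eta>"
proof -
  let ?d = "\<lambda>u. real_of_int (dot e (X u - X v))" and ?U = "{d :: int ^ 'n. norm1 d = 1}"
  have "(\<Sum>u\<in>nbrs G v. ?d u) = (\<Sum>d\<in>?U. real_of_int (dot e d))"
    by (rule sum.reindex_bij_betw[OF bij_nbrs[OF v]])
  also have "\<dots> = (\<Sum>d\<in>?U. real_of_int (dot e (- d)))"
    by (rule sum.reindex_bij_witness[where i = uminus and j = uminus]) auto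
  finally have zero: "(\<Sum>u\<in>nbrs G v. ?d u) = 0"
    using sum.reindex_bij_betw[OF bij_nbrs[OF v], of "\<lambda>d. real_of_int (dot e d)"]
    by (simp add: sum_negf dot_def)
  have "laplacian G f v = (\<Sum>u\<in>nbrs G v. (wt G v u - 1) * ?d u + ?d u)"
    unfolding laplacian_def by (intro sum.cong) (auto simp: nbrs_def f algebra_simps)
  also have "\<dots> = (\<Sum>u\<in>nbrs G v. (wt G v u - 1) * ?d u)"
    using zero by (simp add: sum.distrib)
  finally have "\<bar>laplacian G f v\<bar> \<le> (\<Sum>u\<in>nbrs G v. \<bar>(wt G v u - 1) * ?d u\<bar>)"
    by (simp add: sum_abs)
  also have "\<dots> \<le> (\<Sum>u\<in>nbrs G v. \<eta>)"
  proof (rule sum_mono)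
    fix u assume "u \<in> nbrs G v"
    then have u: "adj G v u" by (simp add: nbrs_def)
    have "\<bar>dot e (X u - X v)\<bar> \<le> 1"
      using dot_le_norm1[OF e, of "X u - X v"] nbr_out(2)[OF v u] by (simp add: norm1_commute)
    then have "\<bar>?d u\<bar> \<le> 1" by linarith
    then have "\<bar>wt G v u - 1\<bar> * \<bar>?d u\<bar> \<le> \<bar>wt G v u - 1\<bar>" by (simp add: mult_left_le)
    then show "\<bar>(wt G v u - 1) * ?d u\<bar> \<le> \<eta>" using w[OF u] by (simp add: abs_mult)
  qed
  also have "\<dots> = real (card ?U) * \<eta>"
    using bij_betw_same_card[OF bij_nbrs[OF v]] by simp
  finally show ?thesis .
qed

subsection \<open>Busemann functions\<close>

definition signs :: "int ^ 'n \<Rightarrow> bool" where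
  "signs e \<longleftrightarrow> e \<noteq> 0 \<and> (\<forall>i. \<bar>e $ i\<bar> \<le> 1)"

text \<open>The threshold \<open>C + 2\<close> lets \<open>nbr_out\<close> apply, so neighbours of
  the half space still lie outside the core.\<close>

definition half :: "int ^ 'n \<Rightarrow> 'v set" where
  "half e = {v \<in> out. C + 2 \<le> dot e (X v)}"

text \<open>Off the half space the value falls by one per unit of distance, so it can be raised by
  walking back towards the half space.\<close>

definition buse :: "int ^ 'n \<Rightarrow> 'v \<Rightarrow> int" where
  "buse e v = (if v \<in> half e then dot e (X v) else C + 2 - int (dset (half e) v))"

lemma signs_minus: "signs e \<Longrightarrow> signs (- e)"
  by (simp add: signs_def)

lemma signs_component:
  assumes "signs e"
  obtains i where "e $ i * e $ i = 1" "\<bar>e $ i\<bar> = 1"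
proof -
  obtain i where i: "e $ i \<noteq> 0" using assms by (auto simp: signs_def vec_eq_iff)
  moreover have "\<bar>e $ i\<bar> \<le> 1" using assms by (simp add: signs_def)
  ultimately have "\<bar>e $ i\<bar> = 1" by linarith
  moreover from this have "e $ i * e $ i = 1" by (auto simp: abs_if split: if_splits)
  ultimately show ?thesis using that by blast
qed

lemma signs_dot_le: "signs e \<Longrightarrow> \<bar>dot e x\<bar> \<le> norm1 x"
  by (rule dot_le_norm1) (simp add: signs_def)

context
  fixes e :: "int ^ 'n"
  assumes e: "signs e"
begin

lemma half_verts: "half e \<subseteq> verts G"
  by (auto simp: half_def)

lemma half_out: "v \<in> half e \<Longrightarrow> v \<in> out"
  by (auto simp: half_def)

lemma half_norm1: "v \<in> half e \<Longrightarrow> C + 2 \<le> norm1 (X v)"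
  using signs_dot_le[OF e, of "X v"] by (auto simp: half_def)

lemma Xi_half:
  assumes "C + 2 \<le> dot e x"
  shows "Xi x \<in> half e" "X (Xi x) = x"
proof -
  have "C < norm1 x" using assms signs_dot_le[OF e, of x] by auto
  then show "X (Xi x) = x" "Xi x \<in> half e" using Xi_out X_Xi assms by (auto simp: half_def)
qed

lemma half_nonempty: "half e \<noteq> {}"
proof -
  obtain i where "e $ i * e $ i = 1" using signs_component[OF e] by blast
  then have "C + 2 \<le> dot e (axis i (e $ i * (C + 2)))" by (simp add: mult.assoc[symmetric])
  then show ?thesis using Xi_half(1) by blast
qed

lemmas half_dset = half_nonempty half_verts

lemma half_nbr:
  assumes "v \<in> half e" "adj G v u"
  shows "u \<in> out" "\<bar>dot e (X u) - dot e (X v)\<bar> \<le> 1"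
proof -
  note n = nbr_out[OF half_out[OF assms(1)] half_norm1[OF assms(1)] assms(2)]
  show "u \<in> out" by (fact n)
  show "\<bar>dot e (X u) - dot e (X v)\<bar> \<le> 1"
    using signs_dot_le[OF e, of "X u - X v"] n(2) by (simp add: dot_diff norm1_commute)
qed

text \<open>An edge changes \<open>dot e\<close> by at most one, so it leaves the half space only
  across the bounding hyperplane. Hence the two branches of \<open>buse\<close> fit together
  there.\<close>

lemma half_exit:
  assumes "v \<in> half e" "adj G v u" "u \<notin> half e"
  shows "dot e (X v) = C + 2" "dot e (X u) = C + 1" "dset (half e) u = 1"
proof -
  have "dot e (X u) < C + 2" using half_nbr(1)[OF assms(1,2)] assms(3) by (auto simp: half_def)
  moreover have "C + 2 \<le> dot e (X v)" using assms(1) by (simp add: half_def)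
  ultimately show "dot e (X v) = C + 2" "dot e (X u) = C + 1"
    using half_nbr(2)[OF assms(1,2)] by auto
  have "u \<in> verts G" "v \<in> verts G" using adj_verts[OF assms(2)] by auto
  then have "dset (half e) u \<noteq> 0" "dset (half e) v = 0"
    using dset_eq_0[OF half_dset] assms by auto
  then show "dset (half e) u = 1"
    using dset_adj_le[OF half_dset adj_sym[OF assms(2)]] by simp
qed

lemma buse_half: "v \<in> half e \<Longrightarrow> buse e v = dot e (X v)"
  by (simp add: buse_def)

lemma buse_near_half:
  assumes "v \<in> half e" "adj G v u"
  shows "buse e u = dot e (X u)"
  using half_exit[OF assms] by (cases "u \<in> half e") (auto simp: buse_def)

lemma buse_lip:
  assumes "adj G u v"
  shows "\<bar>buse e u - buse e v\<bar> \<le> 1"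
proof -
  have half: "\<bar>buse e u - buse e v\<bar> \<le> 1" if "u \<in> half e" "adj G u v" for u v
    using buse_near_half[OF that] buse_half[OF that(1)] half_nbr(2)[OF that]
    by (simp add: abs_minus_commute)
  show ?thesis
  proof (cases "u \<in> half e \<or> v \<in> half e")
    case True
    then show ?thesis
      using half[of u v] half[of v u] assms adj_sym[OF assms] by (auto simp: abs_minus_commute)
  next
    case False
    then show ?thesis
      using dset_adj_le[OF half_dset assms] dset_adj_le[OF half_dset adj_sym[OF assms]]
      by (simp add: buse_def)
  qed
qed

text \<open>Inside the half space, move along a coordinate where \<open>e\<close> is non-zero;
  elsewhere, follow a shortest walk to the half space.\<close>

lemma buse_up:
  assumes "v \<in> verts G"
  shows "\<exists>u. adj G v u \<and> buse e u = buse e v + 1"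
proof (cases "v \<in> half e")
  case True
  obtain i where i: "e $ i * e $ i = 1" "\<bar>e $ i\<bar> = 1" using signs_component[OF e] by blast
  let ?x = "X v + axis i (e $ i)"
  have d: "dot e ?x = dot e (X v) + 1" by (simp add: dot_add i)
  then have "C + 2 \<le> dot e ?x" using True by (simp add: half_def)
  note u = Xi_half[OF this]
  have "adj G v (Xi ?x)"
    using adj_X[OF half_out[OF True] half_out[OF u(1)]] u(2) i(2) norm1_minus[of "axis i (e $ i)"]
    by simp
  then show ?thesis using u d buse_half True by auto
next
  case False
  obtain u where u: "adj G v u" "dset (half e) v = dset (half e) u + 1"
    using dset_step[OF half_dset assms False] by blast
  show ?thesis
  proof (cases "u \<in> half e")
    case True
    then show ?thesis
      using half_exit[OF True adj_sym[OF u(1)] False] False u(1)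
      by (intro exI[of _ u]) (auto simp: buse_def)
  next
    case False
    then show ?thesis using u \<open>v \<notin> half e\<close> by (intro exI[of _ u]) (auto simp: buse_def)
  qed
qed

text \<open>Deep in the half space \<open>buse e\<close> is linear at a vertex and its neighbours,
  so \<open>laplacian_far\<close> gives the asymptotic bound that the climbing argument
  needs.\<close>

lemma buse_subharmonic:
  assumes "v \<in> verts G"
  shows "0 \<le> laplacian G (\<lambda>u. real_of_int (buse e u)) v"
proof (rule laplacian_nonneg_of_climb[OF buse_lip buse_up _ assms])
  fix \<eta> :: real assume eta: "0 < \<eta>"
  let ?N = "real (card {d :: int ^ 'n. norm1 d = 1})"
  have "0 < \<eta> / (?N + 1)" using eta by simp
  then obtain L where L: "\<And>u v. u \<in> out \<Longrightarrow> L \<le> norm1 (X u) \<Longrightarrow> adj G u v \<Longrightarrow>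
      \<bar>wt G u v - 1\<bar> \<le> \<eta> / (?N + 1)"
    using weights by meson
  show "\<exists>L. \<forall>v\<in>verts G. L \<le> buse e v \<longrightarrow> - \<eta> \<le> laplacian G (\<lambda>u. real_of_int (buse e u)) v"
  \<comment> \<open>Off the half space \<open>buse e\<close> is at most \<open>C + 2\<close>, so a
    value of \<open>C + 3\<close> forces \<open>v\<close> into it.\<close>
  proof (intro exI[of _ "max L (C + 3)"] ballI impI)
    fix v assume v: "v \<in> verts G" "max L (C + 3) \<le> buse e v"
    then have h: "v \<in> half e" by (auto simp: buse_def split: if_splits)
    have L': "L \<le> norm1 (X v)"
      using v(2) buse_half[OF h] abs_le_D1[OF signs_dot_le[OF e, of "X v"]] by simp
    have "\<bar>laplacian G (\<lambda>u. real_of_int (buse e u)) v\<bar> \<le> ?N * (\<eta> / (?N + 1))"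
    proof (rule laplacian_far[OF half_out[OF h] half_norm1[OF h], of e])
      show "\<bar>e $ i\<bar> \<le> 1" for i using e by (simp add: signs_def)
      show "real_of_int (buse e u) - real_of_int (buse e v) = real_of_int (dot e (X u - X v))"
        if "adj G v u" for u
        using buse_near_half[OF h that] buse_half[OF h] by (simp add: dot_diff)
    qed (rule L[OF half_out[OF h] L'])
    also have "\<dots> \<le> \<eta>" using eta by (simp add: field_simps)
    finally show "- \<eta> \<le> laplacian G (\<lambda>u. real_of_int (buse e u)) v" by simp
  qed
qed

text \<open>The barrier \<open>max (e \<bullet> x) (2 C + 2 - |x|\<^sub>1)\<close>, extended by a constant to the core, is
  1-Lipschitz and dominates \<open>e \<bullet> x\<close> on the half space, hence dominates the smallest such
  function, which is the Busemann function.\<close>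

definition barrier :: "'v \<Rightarrow> int" where
  "barrier v = (if v \<in> out then max (dot e (X v)) (2 * C + 2 - norm1 (X v)) else C + 2)"

lemma barrier_lip:
  assumes "adj G u v"
  shows "\<bar>barrier u - barrier v\<bar> \<le> 1"
proof -
  have mixed: "\<bar>barrier u - barrier v\<bar> \<le> 1" if "adj G u v" "u \<in> out" "v \<in> core" for u v
  proof -
    \<comment> \<open>Both entries of the maximum are then at most \<open>C + 1\<close> and the
      second equals it, so the barrier is one below its core value.\<close>
    have "norm1 (X u) = C + 1" using out_norm1[OF that(2)] adj_core[OF that(2,3,1)] by simp
    then show ?thesis using signs_dot_le[OF e, of "X u"] that by (simp add: barrier_def)
  qed
  have uv: "u \<in> verts G" "v \<in> verts G" using adj_verts[OF assms] by auto
  consider "u \<in> out" "v \<in> out" | "u \<in> out" "v \<in> core" | "v \<in> out" "u \<in> core" | "u \<in> core" "v \<in> core"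
    using uv by blast
  then show ?thesis
  proof cases
    case 1
    then have n: "norm1 (X u - X v) = 1" using adj_X assms by simp
    then have "\<bar>dot e (X u) - dot e (X v)\<bar> \<le> 1"
      using signs_dot_le[OF e, of "X u - X v"] by (simp add: dot_diff)
    moreover have "\<bar>norm1 (X u) - norm1 (X v)\<bar> \<le> 1"
      using norm1_diff_le[of "X u" "X v"] norm1_diff_le[of "X v" "X u"] n
      by (simp add: norm1_commute)
    ultimately show ?thesis using 1 by (auto simp: barrier_def max_def abs_if split: if_splits)
  next
    case 2
    then show ?thesis using mixed assms by simp
  next
    case 3
    then show ?thesis using mixed[of v u] adj_sym[OF assms] by (simp add: abs_minus_commute)
  next
    case 4
    then show ?thesis by (simp add: barrier_def)
  qed
qed

lemma buse_le_barrier: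
  assumes "v \<in> verts G"
  shows "buse e v \<le> barrier v"
proof (cases "v \<in> half e")
  case True
  then show ?thesis using half_out[OF True] by (simp add: barrier_def buse_def)
next
  case False
  obtain h where h: "h \<in> half e" "(v, h) \<in> E ^^ dset (half e) v"
    using dset_attained[OF half_dset assms] by blast
  have "C + 2 \<le> barrier h" using h(1) by (auto simp: half_def barrier_def)
  moreover have "\<bar>barrier v - barrier h\<bar> \<le> int (dset (half e) v)"
    using edge_lip_relpow[of barrier, OF barrier_lip h(2)] by simp
  ultimately show ?thesis using False by (simp add: buse_def)
qed

lemma buse_le_out:
  "v \<in> out \<Longrightarrow> buse e v \<le> max (dot e (X v)) (2 * C + 2 - norm1 (X v))"
  using buse_le_barrier[of v] by (simp add: barrier_def)

lemma buse_le_core: "v \<in> core \<Longrightarrow> v \<in> verts G \<Longrightarrow> buse e v \<le> C + 2"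
  using buse_le_barrier[of v] by (simp add: barrier_def)

text \<open>Walking \<open>C + 2\<close> unit steps from \<open>x\<close> in a direction that raises
  \<open>dot e\<close> leads into the half space, and by \<open>buse_lip\<close> each step gains at
  most one. The bound on \<open>norm1 x\<close> keeps the walk off the core.\<close>

lemma buse_nonneg:
  assumes "dot e x = 0" "2 * C + 2 < norm1 x"
  shows "0 \<le> buse e (Xi x)"
proof -
  obtain i where i: "e $ i * e $ i = 1" "\<bar>e $ i\<bar> = 1" using signs_component[OF e] by blast
  define y where "y k = x + axis i (e $ i * k)" for k
  have dy: "dot e (y k) = k" for k
    using assms(1) i(1) by (simp add: y_def dot_add mult.assoc[symmetric])
  have ny: "C < norm1 (y k)" if "0 \<le> k" "k \<le> C + 2" for k
    using norm1_diff_le[of x "y k"] assms(2) that i(2) norm1_minus[of "axis i (e $ i * k)"]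
    by (simp add: y_def abs_mult)
  have "C + 2 - int m \<le> buse e (Xi (y (C + 2 - int m)))" if "int m \<le> C + 2" for m
    using that
  proof (induction m)
    case 0
    then show ?case using Xi_half[of "y (C + 2)"] dy buse_half by simp
  next
    case (Suc m)
    let ?k = "C + 2 - int m"
    have n: "C < norm1 (y ?k)" "C < norm1 (y (?k - 1))" using ny Suc.prems by auto
    have "norm1 (y ?k - y (?k - 1)) = 1"
    proof -
      have "y ?k - y (?k - 1) = axis i (e $ i)"
        by (auto simp: y_def vec_eq_iff axis_def algebra_simps)
      then show ?thesis using i by simp
    qed
    then have "adj G (Xi (y ?k)) (Xi (y (?k - 1)))"
      using adj_X[OF Xi_out Xi_out] n X_Xi by simp
    from buse_lip[OF this] Suc show ?case by (simp add: algebra_simps)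
  qed
  from this[of "nat (C + 2)"] have "0 \<le> buse e (Xi (y 0))" using C_nonneg by simp
  moreover have "y 0 = x" by (simp add: y_def vec_eq_iff axis_def)
  ultimately show ?thesis by simp
qed

end

section \<open>Opposite directions and harmonicity\<close>

lemma orthogonal_far:
  assumes e: "signs e"
  obtains x where "dot e x = 0" "L \<le> norm1 x"
proof -
  obtain i where i: "\<bar>e $ i\<bar> = 1" using signs_component[OF e] by blast
  obtain j where j: "j \<noteq> i" using ex_other by blast
  \<comment> \<open>In the plane of coordinates \<open>i\<close> and \<open>j\<close> this is
    \<open>e\<close> turned by a right angle and scaled by \<open>\<bar>L\<bar>\<close>.\<close>
  let ?x = "axis i (\<bar>L\<bar> * e $ j) - axis j (\<bar>L\<bar> * e $ i)"
  have "dot e ?x = 0" by (simp add: dot_diff algebra_simps)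
  moreover have "\<bar>?x $ j\<bar> = \<bar>L\<bar>" using i j by (simp add: axis_def abs_mult)
  then have "L \<le> norm1 ?x" using component_le_norm1[of ?x j] by simp
  ultimately show ?thesis using that by blast
qed

lemma buse_minus:
  assumes e: "signs e" and v: "v \<in> verts G"
  shows "buse (- e) v = - buse e v"
proof -
  note e' = signs_minus[OF e]
  let ?s = "\<lambda>v. buse e v + buse (- e) v"
  obtain x where x: "dot e x = 0" "2 * C + 3 \<le> norm1 x" using orthogonal_far[OF e] by blast
  have u: "Xi x \<in> out" "X (Xi x) = x" using x(2) C_nonneg Xi_out X_Xi by auto
  have "?s v = ?s (Xi x)"
  proof (rule subharmonic_bounded_const)
    show "0 \<le> laplacian G (\<lambda>u. real_of_int (?s u)) w" if "w \<in> verts G" for w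
      using buse_subharmonic[OF e that] buse_subharmonic[OF e' that] by (simp add: laplacian_add)
    \<comment> \<open>In the barriers for \<open>e\<close> and \<open>- e\<close> the linear parts
      cancel, and \<open>\<bar>dot e x\<bar> \<le> norm1 x\<close> bounds the mixed terms.\<close>
    show "?s w \<le> 4 * C + 4" if "w \<in> verts G" for w
    proof (cases "w \<in> out")
      case True
      then show ?thesis
        using buse_le_out[OF e True] buse_le_out[OF e' True] signs_dot_le[OF e, of "X w"] C_nonneg
          out_norm1[OF True] by (simp add: max_def split: if_splits)
    next
      case False
      then have "?s w \<le> 2 * C + 4" using buse_le_core[OF e, of w] buse_le_core[OF e', of w] that by simp
      then show ?thesis using C_nonneg by simp
    qed
  qed (use v u in auto)
  \<comment> \<open>Here \<open>dot e x = 0\<close> and \<open>2 * C + 2 - norm1 x\<close> is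
    negative, so both upper bounds are 0.\<close>
  moreover have "?s (Xi x) \<le> 0"
    using buse_le_out[OF e u(1)] buse_le_out[OF e' u(1)] u(2) x by simp
  moreover have "0 \<le> ?s (Xi x)"
    using buse_nonneg[OF e, of x] buse_nonneg[OF e', of x] x by simp
  ultimately show ?thesis by simp
qed

text \<open>Subharmonicity for \<open>- e\<close> is the reverse inequality for
  \<open>e\<close>.\<close>

lemma buse_harmonic:
  assumes e: "signs e" and v: "v \<in> verts G"
  shows "laplacian G (\<lambda>u. real_of_int (buse e u)) v = 0"
proof -
  have "laplacian G (\<lambda>u. real_of_int (buse (- e) u)) v =
      laplacian G (\<lambda>u. - real_of_int (buse e u)) v"
    by (rule laplacian_cong) (use buse_minus[OF e] v adj_verts in auto)
  then show ?thesis
    using buse_subharmonic[OF e v] buse_subharmonic[OF signs_minus[OF e] v]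
    by (simp add: laplacian_uminus)
qed

lemma buse_far:
  assumes e: "signs e" and v: "v \<in> out" "3 * C + 4 \<le> norm1 (X v)"
  shows "buse e v = dot e (X v)"
proof -
  have "C + 2 \<le> dot e (X v) \<or> C + 2 \<le> - dot e (X v) \<or> \<bar>dot e (X v)\<bar> < C + 2" by linarith
  then consider "v \<in> half e" | "v \<in> half (- e)" | "\<bar>dot e (X v)\<bar> < C + 2"
    using v(1) by (auto simp: half_def)
  then show ?thesis
  proof cases
    case 1
    then show ?thesis by (rule buse_half[OF e])
  next
    case 2
    then show ?thesis using buse_half[OF signs_minus[OF e] 2] buse_minus[OF e] v(1) by simp
  next
    \<comment> \<open>Now \<open>2 * C + 2 - norm1 (X v)\<close> is at most
      \<open>- (C + 2)\<close>, so the upper bounds for \<open>e\<close> and \<open>- e\<close> are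
      the linear ones; by \<open>buse_minus\<close> they are opposite bounds on
      \<open>buse e v\<close>.\<close>
    case 3
    then show ?thesis
      using buse_le_out[OF e v(1)] buse_le_out[OF signs_minus[OF e] v(1)] buse_minus[OF e, of v] v
      by (simp add: max_def split: if_splits)
  qed
qed

subsection \<open>The coordinate map\<close>

definition coords :: "'v \<Rightarrow> int ^ 'n" where
  "coords v = (\<chi> i. buse (axis i 1) v)"

lemma signs_axis: "signs (axis i 1)"
  by (auto simp: signs_def axis_def vec_eq_iff)

lemma coords_far: "v \<in> out \<Longrightarrow> 3 * C + 4 \<le> norm1 (X v) \<Longrightarrow> coords v = X v"
  by (simp add: coords_def vec_eq_iff buse_far[OF signs_axis])

lemma coords_harmonic: "v \<in> verts G \<Longrightarrow> laplacian G (\<lambda>u. real_of_int (coords u $ i)) v = 0"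
  using buse_harmonic[OF signs_axis] by (simp add: coords_def)

lemma finite_near: "finite {v \<in> verts G. v \<in> core \<or> norm1 (X v) < L}"
proof (rule finite_subset)
  show "{v \<in> verts G. v \<in> core \<or> norm1 (X v) < L} \<subseteq> core \<union> Xi ` {x. norm1 x \<le> L}"
  proof
    fix v assume v: "v \<in> {v \<in> verts G. v \<in> core \<or> norm1 (X v) < L}"
    show "v \<in> core \<union> Xi ` {x. norm1 x \<le> L}"
    proof (cases "v \<in> core")
      case False
      then have "v = Xi (X v)" "norm1 (X v) \<le> L" using v Xi_X[of v] by auto
      then show ?thesis by blast
    qed simp
  qed
qed (simp add: finite_core finite_norm1_le)

text \<open>Properness of \<open>coords\<close>: the vertices to be excluded are finite in number,
  so \<open>coords\<close> is bounded on them.\<close>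

lemma norm1_coords_large:
  obtains B where "\<And>v. v \<in> verts G \<Longrightarrow> B \<le> norm1 (coords v) \<Longrightarrow> v \<in> out \<and> L \<le> norm1 (X v)"
proof -
  let ?A = "{v \<in> verts G. v \<in> core \<or> norm1 (X v) < L}"
  have "norm1 (coords v) \<le> Max (insert 0 ((\<lambda>v. norm1 (coords v)) ` ?A))" if "v \<in> ?A" for v
    using that finite_near[of L] by (intro Max_ge) auto
  then show ?thesis
    by (intro that[of "Max (insert 0 ((\<lambda>v. norm1 (coords v)) ` ?A)) + 1"]) force
qed

text \<open>Both sides are harmonic and agree outside a finite set.\<close>

lemma buse_eq_dot:
  assumes e: "signs e" and v: "v \<in> verts G"
  shows "buse e v = dot e (coords v)"
proof -
  let ?s = "\<lambda>v. buse e v - dot e (coords v)" and ?A = "{v \<in> verts G. v \<in> core \<or> norm1 (X v) < 3 * C + 4}"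
  have far: "?s w = 0" if "w \<in> verts G" "w \<notin> ?A" for w
    using that buse_far[OF e, of w] coords_far[of w] by auto
  let ?x = "axis undefined (3 * C + 4) :: int ^ 'n"
  have x: "Xi ?x \<in> out" "X (Xi ?x) = ?x" using C_nonneg Xi_out[of ?x] X_Xi[of ?x] by simp_all
  have "?s v = ?s (Xi ?x)"
  proof (rule subharmonic_bounded_const)
    fix w assume w: "w \<in> verts G"
    \<comment> \<open>The inserted 0 covers the vertices outside \<open>?A\<close>, where the
      difference vanishes.\<close>
    show "?s w \<le> Max (insert 0 (?s ` ?A))"
    proof (cases "w \<in> ?A")
      case True
      then show ?thesis using finite_near by (intro Max_ge) auto
    next
      case False
      then show ?thesis using far[OF w] finite_near by (intro Max_ge) auto
    qed
    have "laplacian G (\<lambda>u. real_of_int (?s u)) w = laplacian G (\<lambda>u. real_of_int (buse e u)) w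
        - (\<Sum>i\<in>UNIV. real_of_int (e $ i) * laplacian G (\<lambda>u. real_of_int (coords u $ i)) w)"
      by (simp add: laplacian_diff dot_def laplacian_sum laplacian_cmult)
    then show "0 \<le> laplacian G (\<lambda>u. real_of_int (?s u)) w"
      using buse_harmonic[OF e w] coords_harmonic[OF w] by simp
  qed (use v x in auto)
  also have "\<dots> = 0" using x far[of "Xi ?x"] C_nonneg by simp
  finally show ?thesis by simp
qed

text \<open>Choosing \<open>e\<close> as the sign vector of \<open>coords u - coords v\<close> turns the Lipschitz bounds of the single
  Busemann functions into an l1 bound.\<close>

lemma coords_lip:
  assumes "adj G u v"
  shows "norm1 (coords u - coords v) \<le> 1"
proof -
  let ?d = "coords u - coords v"
  let ?e = "\<chi> i. sgn (?d $ i)"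
  have d: "dot ?e ?d = norm1 ?d"
    by (simp add: dot_def norm1_def abs_sgn mult.commute del: vector_minus_component)
  show ?thesis
  proof (cases "?e = 0")
    case True
    then have "norm1 ?d = 0" using d by (simp add: dot_def del: norm1_eq_0)
    then show ?thesis by linarith
  next
    case False
    then have e: "signs ?e" by (auto simp: signs_def sgn_if)
    have "norm1 ?d = buse ?e u - buse ?e v"
      using d buse_eq_dot[OF e] adj_verts[OF assms] by (simp add: dot_diff)
    then show ?thesis using buse_lip[OF e assms] by simp
  qed
qed

text \<open>A unit change in one coordinate exhausts the l1 bound of \<open>coords_lip\<close>, so
  no other coordinate moves.\<close>

lemma coords_nbr_component:
  assumes "adj G v u" "\<bar>coords u $ i - coords v $ i\<bar> = 1"
  shows "coords u = coords v + axis i (coords u $ i - coords v $ i)"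
  using norm1_le_1_component[of "coords u - coords v" i] coords_lip[OF adj_sym[OF assms(1)]] assms(2)
  by (simp add: algebra_simps)

lemma coords_up:
  assumes "v \<in> verts G"
  shows "\<exists>u. adj G v u \<and> coords u = coords v + axis i 1"
proof -
  obtain u where u: "adj G v u" "coords u $ i = coords v $ i + 1"
    using buse_up[OF signs_axis assms] by (auto simp: coords_def)
  then show ?thesis using coords_nbr_component[OF u(1), of i] by auto
qed

subsection \<open>Edge weights\<close>

text \<open>Until injectivity of \<open>coords\<close> is known, several neighbours may share the
  same coordinates; hence a sum.\<close>

definition up_wt :: "'n \<Rightarrow> 'v \<Rightarrow> real" where
  "up_wt j v = (\<Sum>u\<in>{u \<in> nbrs G v. coords u = coords v + axis j 1}. wt G v u)"

definition down_wt :: "'n \<Rightarrow> 'v \<Rightarrow> real" where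
  "down_wt j v = (\<Sum>u\<in>{u \<in> nbrs G v. coords v = coords u + axis j 1}. wt G v u)"

lemma coords_nbr_cases:
  assumes "adj G v u"
  shows "coords u $ j - coords v $ j =
    (if coords u = coords v + axis j 1 then 1 else if coords v = coords u + axis j 1 then - 1 else 0)"
proof -
  have "\<bar>coords u $ j - coords v $ j\<bar> \<le> 1"
    using component_le_norm1[of "coords u - coords v" j] coords_lip[OF adj_sym[OF assms]] by simp
  then consider "coords u $ j - coords v $ j = 0" | "coords u $ j - coords v $ j = 1" | "coords v $ j - coords u $ j = 1" by linarith
  then show ?thesis
  proof cases
    case 1
    then show ?thesis by (auto simp: vec_eq_iff axis_def)
  next
    case 2
    then show ?thesis using coords_nbr_component[OF assms, of j] by auto
  next
    case 3
    then have "coords v = coords u + axis j 1" using coords_nbr_component[OF adj_sym[OF assms], of j] by auto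
    then show ?thesis using 3 by (auto simp: vec_eq_iff axis_def)
  qed
qed

text \<open>The positive part centred at \<open>v\<close> vanishes at level and lower neighbours and
  is 1 at upper ones.\<close>

lemma up_wt_eq_laplacian:
  assumes v: "v \<in> verts G"
  shows "laplacian G (\<lambda>u. real_of_int (max (coords u $ j - coords v $ j) 0)) v = up_wt j v"
proof -
  have "laplacian G (\<lambda>u. real_of_int (max (coords u $ j - coords v $ j) 0)) v =
      (\<Sum>u\<in>nbrs G v. if coords u = coords v + axis j 1 then wt G v u else 0)"
    unfolding laplacian_def by (intro sum.cong) (auto simp: nbrs_def coords_nbr_cases[of v _ j])
  then show ?thesis
    unfolding up_wt_def by (simp add: sum.inter_filter[OF finite_nbrs[OF v]])
qed

text \<open>The difference of the two is the Laplacian of the harmonic coordinate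
  \<open>j\<close>.\<close>

lemma up_wt_eq_down_wt:
  assumes v: "v \<in> verts G"
  shows "up_wt j v = down_wt j v"
proof -
  have ne: "\<not> (x = coords v + axis j 1 \<and> coords v = x + axis j 1)" for x
  proof
    assume "x = coords v + axis j 1 \<and> coords v = x + axis j 1"
    then have "x $ j = coords v $ j + 1" "coords v $ j = x $ j + 1" by (metis axis_nth vector_add_component)+
    then show False by simp
  qed
  have "laplacian G (\<lambda>u. real_of_int (coords u $ j)) v =
      (\<Sum>u\<in>nbrs G v. (if coords u = coords v + axis j 1 then wt G v u else 0)
        - (if coords v = coords u + axis j 1 then wt G v u else 0))"
    unfolding laplacian_def of_int_diff[symmetric]
    by (intro sum.cong) (use ne in \<open>auto simp: nbrs_def coords_nbr_cases[of v _ j]\<close>)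
  then have "laplacian G (\<lambda>u. real_of_int (coords u $ j)) v = up_wt j v - down_wt j v"
    unfolding up_wt_def down_wt_def sum_subtractf
    by (simp add: sum.inter_filter[OF finite_nbrs[OF v]])
  then show ?thesis using coords_harmonic[OF v] by simp
qed

text \<open>The functions \<open>x\<^sub>i \<plusminus> max (x\<^sub>j - c) 0\<close>, where \<open>x = coords\<close>, are 1-Lipschitz
  because an edge changes only one coordinate; their Laplacians at a vertex with \<open>x\<^sub>j = c\<close> are \<open>\<plusminus> up_wt j\<close>.\<close>

lemma up_wt_step:
  assumes ij: "i \<noteq> j" and a: "adj G v u" and up: "coords u $ i = coords v $ i + 1"
  shows "up_wt j u = up_wt j v"
proof -
  have coords: "coords u = coords v + axis i 1" using coords_nbr_component[OF a, of i] up by simp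
  then have j: "coords u $ j = coords v $ j" using ij by (simp add: axis_def)
  have v: "v \<in> verts G" "u \<in> verts G" using adj_verts[OF a] by auto
  let ?p = "\<lambda>w. real_of_int (max (coords w $ j - coords v $ j) 0)"
  have "\<sigma> * up_wt j u \<le> \<sigma> * up_wt j v" if s: "\<bar>\<sigma>\<bar> = 1" for \<sigma> :: real
  proof -
    let ?f = "\<lambda>w. real_of_int (coords w $ i) + \<sigma> * ?p w"
    have "laplacian G ?f u \<le> laplacian G ?f v"
    proof (rule laplacian_antimono[OF _ a])
      show "?f u = ?f v + 1" using up j by simp
      fix x y assume "adj G x y"
      then have "\<bar>coords x $ i - coords y $ i\<bar> + \<bar>coords x $ j - coords y $ j\<bar> \<le> 1"
        using norm1_remove_le[of j i "coords x - coords y"] coords_lip[of x y] ij by simp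
      then have "\<bar>coords x $ i - coords y $ i\<bar> + \<bar>max (coords x $ j - coords v $ j) 0 - max (coords y $ j - coords v $ j) 0\<bar> \<le> 1"
        by (auto simp: max_def abs_if split: if_splits)
      then have "\<bar>real_of_int (coords x $ i) - real_of_int (coords y $ i)\<bar> + \<bar>?p x - ?p y\<bar> \<le> 1"
        unfolding of_int_diff[symmetric] of_int_abs[symmetric] of_int_add[symmetric] of_int_le_1_iff .
      moreover have "\<bar>\<sigma> * (?p x - ?p y)\<bar> = \<bar>?p x - ?p y\<bar>"
        using s by (simp add: abs_mult del: of_int_diff)
      ultimately have "\<bar>(real_of_int (coords x $ i) - real_of_int (coords y $ i)) + \<sigma> * (?p x - ?p y)\<bar> \<le> 1"
        by linarith
      then show "\<bar>?f x - ?f y\<bar> \<le> 1" by (simp add: algebra_simps)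
    qed
    \<comment> \<open>Harmonicity removes the term of coordinate \<open>i\<close>; since
      \<open>u\<close> and \<open>v\<close> share coordinate \<open>j\<close>, \<open>?p\<close> is
      centred at both. The two signs of \<open>\<sigma>\<close> then give opposite
      inequalities.\<close>
    then show ?thesis
      using up_wt_eq_laplacian[OF v(1), of j] up_wt_eq_laplacian[OF v(2), of j] j
        coords_harmonic[OF v(1), of i] coords_harmonic[OF v(2), of i]
      by (simp add: laplacian_add laplacian_cmult)
  qed
  from this[of 1] this[of "-1"] show ?thesis by simp
qed

text \<open>The radius exceeds that of \<open>coords_far\<close> by one, so \<open>coords\<close> is
  \<open>X\<close> at every neighbour of \<open>u\<close> and exactly one neighbour lies above
  \<open>u\<close>.\<close>

lemma up_wt_far:
  assumes u: "u \<in> out" "3 * C + 5 \<le> norm1 (X u)"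
    and w: "\<And>v. adj G u v \<Longrightarrow> \<bar>wt G u v - 1\<bar> \<le> \<eta>"
  shows "\<bar>up_wt j u - 1\<bar> \<le> \<eta>"
proof -
  have n: "C + 2 \<le> norm1 (X u)" using u(2) C_nonneg by simp
  obtain v where v: "adj G u v" "coords v = coords u + axis j 1" using coords_up u(1) by blast
  have FX: "coords x = X x" if "adj G u x" for x
  proof (rule coords_far)
    show "x \<in> out" using nbr_out(1)[OF u(1) n that] .
    show "3 * C + 4 \<le> norm1 (X x)"
      using nbr_out(2)[OF u(1) n that] norm1_diff_le[of "X u" "X x"] u(2) by simp
  qed
  have "x = v" if x: "adj G u x" "coords x = coords u + axis j 1" for x
  proof -
    have "X x = X v" using FX[OF x(1)] FX[OF v(1)] x(2) v(2) by metis
    then show ?thesis using Xi_X nbr_out(1)[OF u(1) n x(1)] nbr_out(1)[OF u(1) n v(1)] by metis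
  qed
  then have "{x \<in> nbrs G u. coords x = coords u + axis j 1} = {v}" using v unfolding nbrs_def by blast
  then show ?thesis using w[OF v(1)] by (simp add: up_wt_def)
qed

text \<open>Climbing in a transverse direction \<open>i\<close> preserves \<open>up_wt j\<close> by
  \<open>up_wt_step\<close> and leads out to where \<open>up_wt_far\<close> applies.\<close>

lemma up_wt_eq_1:
  assumes v: "v \<in> verts G"
  shows "up_wt j v = 1"
proof -
  obtain i where i: "i \<noteq> j" using ex_other by blast
  have "\<bar>up_wt j v - 1\<bar> \<le> \<eta>" if eta: "0 < \<eta>" for \<eta> :: real
  proof -
    obtain L where L: "\<And>u v. u \<in> out \<Longrightarrow> L \<le> norm1 (X u) \<Longrightarrow> adj G u v \<Longrightarrow> \<bar>wt G u v - 1\<bar> \<le> \<eta>"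
      using weights[OF eta] by meson
    obtain B where B: "\<And>u. u \<in> verts G \<Longrightarrow> B \<le> norm1 (coords u) \<Longrightarrow>
        u \<in> out \<and> max L (3 * C + 5) \<le> norm1 (X u)"
      using norm1_coords_large by blast
    have "\<exists>u\<in>verts G. coords u $ i = coords v $ i + int (nat (B - coords v $ i)) \<and> up_wt j u = up_wt j v"
    proof (rule climb[OF _ _ v])
      show "\<exists>u. adj G v u \<and> coords u $ i = coords v $ i + 1" if "v \<in> verts G" for v
        using coords_up[OF that, of i] by (auto simp: axis_def)
      show "up_wt j z = up_wt j v" if "adj G y z" "coords z $ i = coords y $ i + 1" "up_wt j y = up_wt j v" for y z
        using up_wt_step[OF i that(1,2)] that(3) by simp
    qed simp
    then obtain u where u: "u \<in> verts G" "B \<le> coords u $ i" "up_wt j u = up_wt j v" by auto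
    then have "B \<le> norm1 (coords u)" using component_le_norm1[of "coords u" i] by simp
    then have "u \<in> out" "L \<le> norm1 (X u)" "3 * C + 5 \<le> norm1 (X u)" using B[OF u(1)] by auto
    then have "\<bar>up_wt j u - 1\<bar> \<le> \<eta>" using L by (intro up_wt_far) auto
    then show ?thesis using u(3) by simp
  qed
  then have "\<bar>up_wt j v - 1\<bar> \<le> 0" by (intro field_le_epsilon[of _ 0]) simp
  then show ?thesis by simp
qed

subsection \<open>Bijectivity\<close>

definition fibre :: "int ^ 'n \<Rightarrow> 'v set" where
  "fibre x = {v \<in> verts G. coords v = x}"

lemma fibre_far: "\<exists>B. \<forall>x. B \<le> norm1 x \<longrightarrow> fibre x = {Xi x}"
proof -
  obtain B where B: "\<And>u. u \<in> verts G \<Longrightarrow> B \<le> norm1 (coords u) \<Longrightarrow> u \<in> out \<and> 3 * C + 4 \<le> norm1 (X u)"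
    using norm1_coords_large by blast
  have "fibre x = {Xi x}" if x: "max B (3 * C + 4) \<le> norm1 x" for x
  proof
    have "C < norm1 x" using x C_nonneg by simp
    then show "{Xi x} \<subseteq> fibre x" using coords_far[OF Xi_out] Xi_out X_Xi x by (auto simp: fibre_def)
    show "fibre x \<subseteq> {Xi x}"
    proof
      fix v assume "v \<in> fibre x"
      then have v: "v \<in> verts G" "coords v = x" by (auto simp: fibre_def)
      then have "v \<in> out" "3 * C + 4 \<le> norm1 (X v)" using B[OF v(1)] x by auto
      then show "v \<in> {Xi x}" using coords_far[of v] Xi_X[of v] v(2) by simp
    qed
  qed
  then show ?thesis by blast
qed

lemma finite_fibre: "finite (fibre x)"
proof (rule finite_subset)
  show "fibre x \<subseteq> {v \<in> verts G. v \<in> core \<or> norm1 (X v) < 3 * C + 4} \<union> {Xi x}"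
  proof
    fix v assume v: "v \<in> fibre x"
    show "v \<in> {v \<in> verts G. v \<in> core \<or> norm1 (X v) < 3 * C + 4} \<union> {Xi x}"
      using v coords_far[of v] Xi_X[of v] by (cases "v \<in> core") (auto simp: fibre_def not_less)
  qed
qed (simp add: finite_near)

text \<open>The total weight between the fibres over \<open>x\<close> and \<open>x + e\<^sub>j\<close> is the cardinality of either.\<close>

lemma card_fibre_step: "card (fibre (x + axis j 1)) = card (fibre x)"
proof -
  let ?y = "x + axis j 1"
  \<comment> \<open>Extension by 0 lets both sums range over whole fibres, so that they can be
    swapped.\<close>
  let ?w = "\<lambda>v u. if adj G v u then wt G v u else 0"
  have up: "up_wt j v = (\<Sum>u\<in>fibre ?y. ?w v u)" if "v \<in> fibre x" for v
  proof -
    have "{u \<in> nbrs G v. coords u = coords v + axis j 1} = {u \<in> fibre ?y. adj G v u}"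
      using that adj_verts by (auto simp: fibre_def nbrs_def)
    then show ?thesis by (simp add: up_wt_def sum.inter_filter[OF finite_fibre])
  qed
  have down: "down_wt j u = (\<Sum>v\<in>fibre x. ?w v u)" if "u \<in> fibre ?y" for u
  proof -
    have "{v \<in> nbrs G u. coords u = coords v + axis j 1} = {v \<in> fibre x. adj G v u}"
      using that adj_verts adj_sym by (auto simp: fibre_def nbrs_def)
    then show ?thesis by (simp add: down_wt_def wt_sym[of u] sum.inter_filter[OF finite_fibre])
  qed
  have "real (card (fibre x)) = (\<Sum>v\<in>fibre x. up_wt j v)"
    by (simp add: up_wt_eq_1 fibre_def)
  also have "\<dots> = (\<Sum>v\<in>fibre x. \<Sum>u\<in>fibre ?y. ?w v u)" by (simp add: up)
  also have "\<dots> = (\<Sum>u\<in>fibre ?y. \<Sum>v\<in>fibre x. ?w v u)" by (rule sum.swap)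
  also have "\<dots> = (\<Sum>u\<in>fibre ?y. down_wt j u)" by (simp add: down)
  also have "\<dots> = real (card (fibre ?y))"
    by (simp add: up_wt_eq_down_wt[symmetric] up_wt_eq_1 fibre_def)
  finally show ?thesis by simp
qed

text \<open>Fibres along a coordinate line have equal size, and far out they are singletons.\<close>

lemma card_fibre: "card (fibre x) = 1"
proof -
  obtain B where B: "\<And>x. B \<le> norm1 x \<Longrightarrow> fibre x = {Xi x}" using fibre_far by blast
  define j :: 'n where "j = undefined"
  have shift: "card (fibre (x + axis j (int k))) = card (fibre x)" for k
  proof (induction k)
    case 0
    have "axis j 0 = (0 :: int ^ 'n)" by (simp add: vec_eq_iff axis_def)
    then show ?case by (metis add_0_right of_nat_0)
  next
    case (Suc k)
    have "x + axis j (int (Suc k)) = (x + axis j (int k)) + axis j 1"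
      by (simp add: vec_eq_iff axis_def)
    then show ?case using card_fibre_step Suc by metis
  qed
  \<comment> \<open>By the triangle inequality a shift of this length brings the norm to at least
    \<open>B\<close>.\<close>
  define k where "k = nat (norm1 x + B)"
  have "norm1 x + B \<le> int k" by (simp add: k_def)
  then have "B \<le> norm1 (x + axis j (int k))"
    using norm1_diff_le[of "axis j (int k)" "x + axis j (int k)"] by simp
  then show ?thesis using shift[of k] B by simp
qed

lemma coords_bij: "bij_betw coords (verts G) UNIV"
proof (rule bij_betw_imageI)
  show "inj_on coords (verts G)"
  proof (rule inj_onI)
    fix u v assume "u \<in> verts G" "v \<in> verts G" "coords u = coords v"
    then have "u \<in> fibre (coords v)" "v \<in> fibre (coords v)" by (auto simp: fibre_def)
    then show "u = v" using card_fibre[of "coords v"] by (metis card_1_singletonE singletonD)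
  qed
  have "x \<in> coords ` verts G" for x
    using card_fibre[of x] by (auto simp: fibre_def card_1_singleton_iff)
  then show "coords ` verts G = UNIV" by auto
qed

lemma coords_inj: "u \<in> verts G \<Longrightarrow> v \<in> verts G \<Longrightarrow> coords u = coords v \<Longrightarrow> u = v"
  using coords_bij by (auto simp: bij_betw_def inj_on_def)

text \<open>By injectivity the upper neighbour given by \<open>coords_up\<close> is
  \<open>v\<close>, and it is the only summand of \<open>up_wt j u\<close>, which is 1.\<close>

lemma adj_wt_up:
  assumes "u \<in> verts G" "v \<in> verts G" "coords v = coords u + axis j 1"
  shows "adj G u v" "wt G u v = 1"
proof -
  show a: "adj G u v" using coords_up[OF assms(1), of j] coords_inj[OF assms(2)] assms(3) adj_verts by metis
  have "{x \<in> nbrs G u. coords x = coords u + axis j 1} = {v}"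
    using a assms coords_inj adj_verts by (auto simp: nbrs_def)
  then show "wt G u v = 1" using up_wt_eq_1[OF assms(1), of j] by (simp add: up_wt_def)
qed

lemma adj_wt_coords:
  assumes uv: "u \<in> verts G" "v \<in> verts G" and "norm1 (coords u - coords v) = 1"
  shows "adj G u v" "wt G u v = 1"
proof -
  obtain j where "coords u = coords v + axis j 1 \<or> coords v = coords u + axis j 1"
    using norm1_eq_1E[OF assms(3)]
  proof cases
    case (1 i)
    then show ?thesis using that[of i] by (simp add: algebra_simps)
  next
    case (2 i)
    have "axis i (- 1) = - (axis i 1 :: int ^ 'n)" by (simp add: vec_eq_iff axis_def)
    then show ?thesis using that[of i] 2 by (simp add: algebra_simps)
  qed
  then show "adj G u v" "wt G u v = 1"
    using adj_wt_up uv adj_sym wt_sym by metis+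
qed

lemma adj_coords_iff:
  assumes "u \<in> verts G" "v \<in> verts G"
  shows "adj G u v \<longleftrightarrow> norm1 (coords u - coords v) = 1"
proof
  assume a: "adj G u v"
  then have "coords u - coords v \<noteq> 0" using coords_inj[OF assms] adj_verts[OF a] by auto
  then show "norm1 (coords u - coords v) = 1"
    using coords_lip[OF a] norm1_nonneg[of "coords u - coords v"] norm1_eq_0[of "coords u - coords v"] by linarith
qed (rule adj_wt_coords[OF assms])

end

subsection \<open>Passing from asymptotic flatness to a finite core\<close>

lemma adj_grid: "adj (grid_graph w) x y \<longleftrightarrow> norm1 (x - y) = 1"
  using norm1_commute[of x y]
  by (auto simp: adj_def grid_graph_def norm1_def doubleton_eq_iff)

lemma adj_induced: "adj (induced G U) x y \<longleftrightarrow> adj G x y \<and> x \<in> U \<and> y \<in> U"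
  by (auto simp: adj_def induced_def)

lemma wt_induced [simp]: "wt (induced G U) x y = wt G x y"
  by (simp add: wt_def induced_def)

lemma norm1_le_enorm: "real_of_int (norm1 x) \<le> real CARD('n) * enorm (x :: int ^ 'n)"
proof -
  have "real_of_int (norm1 x) = (\<Sum>i\<in>UNIV. \<bar>(\<chi> i. real_of_int (x $ i)) $ i\<bar>)"
    by (simp add: norm1_def)
  also have "\<dots> \<le> (\<Sum>i\<in>(UNIV :: 'n set). enorm x)"
    unfolding enorm_def by (intro sum_mono component_le_norm_cart)
  finally show ?thesis by simp
qed

lemma norm1_cube:
  assumes "x \<in> (cube r :: (int ^ 'n) set)"
  shows "norm1 x \<le> int (CARD('n) * r)"
proof -
  have "norm1 x \<le> (\<Sum>i\<in>(UNIV :: 'n set). int r)"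
    unfolding norm1_def using assms by (intro sum_mono) (simp add: cube_def)
  then show ?thesis by simp
qed

theorem theorem1p10:
  fixes G :: "'v wgraph"
  assumes "CARD('n::finite) \<ge> 2"
    and "weighted_graph G"
    and "asymptotically_flat TYPE('n) G"
    and "nonneg_ricci G"
  shows "weighted_isomorphic G (standard_grid :: (int ^ 'n) wgraph)"
proof -
  interpret nonneg_wgraph G by standard (use assms in auto)
  obtain w :: "(int ^ 'n) set \<Rightarrow> real" and p K r \<Phi> where flat: "flat_grid p (grid_graph w)"
    and K: "finite K"
    and iso: "weighted_iso \<Phi> (induced G (verts G - K)) (induced (grid_graph w) (- cube r))"
    and sep: "edges_between G K {v \<in> verts G - K. \<Phi> v \<in> - cube (r + 1)} = {}"
    using assms(3) unfolding asymptotically_flat_def by blast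
  \<comment> \<open>By \<open>norm1_cube\<close>, l1 norm above \<open>C\<close> means lying outside
    \<open>cube (r + 1)\<close>, where no edge to \<open>K\<close> starts. The core absorbs the
    finitely many vertices in between.\<close>
  define C where "C = int (CARD('n) * (r + 1))"
  define core where "core = K \<union> {v \<in> verts G - K. norm1 (\<Phi> v) \<le> C}"
  have far: "x \<in> - cube r" "x \<in> - cube (r + 1)" if "C < norm1 x" for x :: "int ^ 'n"
  proof -
    show "x \<in> - cube (r + 1)" using norm1_cube[of x "r + 1"] that by (auto simp: C_def)
    moreover have "cube r \<subseteq> (cube (r + 1) :: (int ^ 'n) set)"
      by (auto simp: cube_def intro: add_increasing add_increasing2)
    ultimately show "x \<in> - cube r" by blast
  qed
  have bij: "bij_betw \<Phi> (verts G - K) (- cube r)"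
    using iso unfolding weighted_iso_def
    by (simp add: induced_def grid_graph_def Diff_eq Int_absorb1 Int_left_absorb)
  have adj_\<Phi>: "adj G u v \<longleftrightarrow> norm1 (\<Phi> u - \<Phi> v) = 1"
    and wt_\<Phi>: "adj G u v \<Longrightarrow> wt G u v = wt (grid_graph w) (\<Phi> u) (\<Phi> v)"
    if "u \<in> verts G - K" "v \<in> verts G - K" for u v
  proof -
    have "u \<in> verts (induced G (verts G - K))" "v \<in> verts (induced G (verts G - K))"
      using that by (auto simp: induced_def)
    moreover have "\<Phi> u \<in> - cube r" "\<Phi> v \<in> - cube r"
      using that bij by (auto simp: bij_betw_def)
    ultimately show "adj G u v \<longleftrightarrow> norm1 (\<Phi> u - \<Phi> v) = 1"
      "adj G u v \<Longrightarrow> wt G u v = wt (grid_graph w) (\<Phi> u) (\<Phi> v)"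
      using iso that unfolding weighted_iso_def by (auto simp: adj_induced adj_grid)
  qed
  have out: "verts G - core = {v \<in> verts G - K. C < norm1 (\<Phi> v)}"
    by (auto simp: core_def)
  have nbr: "v \<in> verts G - K" if "u \<in> verts G - core" "adj G u v" for u v
  proof -
    have "{v, u} \<in> edges_between G K {v \<in> verts G - K. \<Phi> v \<in> - cube (r + 1)}" if "v \<in> K"
      using that \<open>u \<in> verts G - core\<close> adj_sym[OF \<open>adj G u v\<close>] far(2)[of "\<Phi> u"]
      unfolding edges_between_def out by blast
    then show ?thesis using sep adj_verts[OF that(2)] by auto
  qed
  interpret flat_end G core \<Phi> C
  proof
    show "2 \<le> CARD('n)" by (fact assms(1))
    show "0 \<le> C" by (simp add: C_def)
    show "finite core"
    proof -
      have "\<Phi> ` {v \<in> verts G - K. norm1 (\<Phi> v) \<le> C} \<subseteq> {x. norm1 x \<le> C}" by auto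
      then have "finite {v \<in> verts G - K. norm1 (\<Phi> v) \<le> C}"
        using finite_subset[OF _ finite_norm1_le] bij
        by (intro finite_imageD[of \<Phi>]) (auto simp: bij_betw_def inj_on_def)
      then show ?thesis using K by (simp add: core_def)
    qed
    have "\<Phi> ` (verts G - core) = {x :: int ^ 'n. C < norm1 x}"
    proof
      show "{x :: int ^ 'n. C < norm1 x} \<subseteq> \<Phi> ` (verts G - core)"
      proof
        fix x assume x: "x \<in> {x :: int ^ 'n. C < norm1 x}"
        then have "x \<in> \<Phi> ` (verts G - K)" using far(1)[of x] bij by (simp add: bij_betw_def)
        then show "x \<in> \<Phi> ` (verts G - core)" using x unfolding out by blast
      qed
    qed (auto simp: out)
    then show "bij_betw \<Phi> (verts G - core) {x. C < norm1 x}"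
      using bij unfolding bij_betw_def by (auto simp: out inj_on_def)
    show "adj G u v \<longleftrightarrow> norm1 (\<Phi> u - \<Phi> v) = 1"
      if "u \<in> verts G - core" "v \<in> verts G - core" for u v
      using that adj_\<Phi> by (auto simp: core_def)
    show "norm1 (\<Phi> u) \<le> C + 1" if "u \<in> verts G - core" "v \<in> core" "adj G u v" for u v
    proof -
      have v: "v \<in> verts G - K" using nbr[OF that(1,3)] .
      then have "norm1 (\<Phi> v) \<le> C" using that(2) by (simp add: core_def)
      then show ?thesis
        using adj_\<Phi>[of u v] v that norm1_diff_le[of "\<Phi> u" "\<Phi> v"] by (auto simp: out)
    qed
    fix \<eta> :: real assume "0 < \<eta>"
    then obtain N where N: "\<And>x y. N \<le> enorm x \<Longrightarrow> adj (grid_graph w) x y \<Longrightarrow>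
        \<bar>wt (grid_graph w) x y - 1\<bar> < \<eta>"
      using flat unfolding flat_grid_def at_grid_infinity_def eventually_filtercomap
        eventually_at_top_linorder by meson
    show "\<exists>L. \<forall>u\<in>verts G - core. L \<le> norm1 (\<Phi> u) \<longrightarrow> (\<forall>v. adj G u v \<longrightarrow> \<bar>wt G u v - 1\<bar> \<le> \<eta>)"
    \<comment> \<open>By \<open>norm1_le_enorm\<close>, an l1 norm above this threshold forces the
      Euclidean norm to be at least \<open>N\<close>.\<close>
    proof (intro exI[of _ "\<lceil>real CARD('n) * N\<rceil>"] ballI allI impI)
      fix u v assume u: "u \<in> verts G - core" "\<lceil>real CARD('n) * N\<rceil> \<le> norm1 (\<Phi> u)" and a: "adj G u v"
      have "real CARD('n) * N \<le> real_of_int (norm1 (\<Phi> u))"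
        using u(2) by (simp add: ceiling_le_iff)
      also note norm1_le_enorm
      finally have "real CARD('n) * N \<le> real CARD('n) * enorm (\<Phi> u)" .
      then have "N \<le> enorm (\<Phi> u)" by simp
      moreover have uv: "u \<in> verts G - K" "v \<in> verts G - K" using u(1) nbr[OF u(1) a] by (auto simp: out)
      moreover have "adj (grid_graph w) (\<Phi> u) (\<Phi> v)" using adj_\<Phi>[OF uv] a by (simp add: adj_grid)
      ultimately show "\<bar>wt G u v - 1\<bar> \<le> \<eta>" using N wt_\<Phi>[OF uv a] by fastforce
    qed
  qed
  have "weighted_iso coords G standard_grid"
    unfolding weighted_iso_def
    using coords_bij adj_coords_iff adj_wt_coords(2)
    by (auto simp: standard_grid_def adj_grid) (auto simp: grid_graph_def wt_def)
  then show ?thesis unfolding weighted_isomorphic_def by blast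
qed

end
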